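(* A planar map $G$ is internally 3-connected if and only if there exist three vertices $x_0,x_1,x_2$ on the outer face of $G$ such that the toroidal map $G^+$ (built from $G$ and $x_0,x_1,x_2$) is an essentially 3-connected toroidal map.
   Context: A planar map $G$ is internally 3-connected if there exist three vertices on its outer face such that the graph obtained from $G$ by adding a new vertex adjacent to these three vertices is 3-connected. Given three vertices $x_0,x_1,x_2$ in counterclockwise order on the outer face of $G$, $G^+$ is the toroidal map obtained by adding a vertex $v$ in the outer face, embedding on the torus with three pairwise non-homotopic non-contractible loops at $v$, and joining each $x_i$ to $v$ by an edge such that no two of these three edges enter $v$ consecutively. The universal cover $G^\infty$ of a graph embedded on the torus is the infinite planar graph obtained by tiling the plane with copies of a flat torus representation; a toroidal map is essentially 3-connected if its universal cover is 3-connected. *)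

theory Defs
  imports
    "Graph_Theory.Graph_Theory"
    "HOL-Combinatorics.Orbits"
    "HOL-Library.Numeral_Type"
    "HOL-Library.Product_Plus"
begin

section \<open>Connectivity\<close>

text \<open>
  The graph may be infinite. Loops and parallel edges are allowed and do not influence the notion.
\<close>

definition k_connected :: "nat \<Rightarrow> ('a, 'b) pre_digraph \<Rightarrow> bool" where
  "k_connected k G \<longleftrightarrow>
     (infinite (verts G) \<or> k < card (verts G)) \<and>
     (\<forall>S \<subseteq> verts G. finite S \<and> card S < k \<longrightarrow> connected (G \<restriction> (verts G - S)))"


section \<open>Maps on surfaces\<close>

text \<open>
  A map on an oriented closed surface (a connected graph embedded such that all faces are open
  disks) is given by its rotation system. The arcs of the digraph are the half-edges: an arc and
  its image under \<open>opp\<close> are the two orientations of one edge. The permutation \<open>rot\<close> sends an arc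
  to the next arc in counterclockwise order around their common tail.
\<close>

record ('a, 'b) cmap =
  graph :: "('a, 'b) pre_digraph"
  opp :: "'b \<Rightarrow> 'b"
  rot :: "'b \<Rightarrow> 'b"

locale combinatorial_map =
  fin_digraph "graph M" + bidirected_digraph "graph M" "opp M"
  for M :: "('a, 'b) cmap" +
  assumes rot_permutes: "rot M permutes arcs (graph M)"
    and rot_cyclic: "\<And>u. u \<in> verts (graph M) \<Longrightarrow> out_arcs (graph M) u \<noteq> {} \<Longrightarrow>
           cyclic_on (rot M) (out_arcs (graph M) u)"
    and map_connected: "connected (graph M)"

text \<open>
  Iterating \<open>face_succ\<close> traces the boundary of the face to the right of an arc. For the
  outer face of a planar map, drawn as the unbounded face, this is a counterclockwise walk around
  the map.
\<close>

definition face_succ :: "('a, 'b) cmap \<Rightarrow> 'b \<Rightarrow> 'b" where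
  "face_succ M = rot M \<circ> opp M"

definition face_of :: "('a, 'b) cmap \<Rightarrow> 'b \<Rightarrow> 'b set" where
  "face_of M a = orbit (face_succ M) a"

text \<open>The connected map without edges has a single face, with no arc on its boundary.\<close>

definition faces :: "('a, 'b) cmap \<Rightarrow> 'b set set" where
  "faces M = (if arcs (graph M) = {} then {{}} else face_of M ` arcs (graph M))"

definition face_verts :: "('a, 'b) cmap \<Rightarrow> 'b set \<Rightarrow> 'a set" where
  "face_verts M f =
     (if arcs (graph M) = {} then verts (graph M) else tail (graph M) ` f)"

definition euler_char :: "('a, 'b) cmap \<Rightarrow> int" where
  "euler_char M =
     int (card (verts (graph M))) - int (card (arcs (graph M)) div 2) + int (card (faces M))"

definition planar_map :: "('a, 'b) cmap \<Rightarrow> 'b set \<Rightarrow> bool" where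
  \<comment> \<open>a map on the sphere with a distinguished outer face \<open>f\<close>\<close>
  "planar_map M f \<longleftrightarrow> combinatorial_map M \<and> euler_char M = 2 \<and> f \<in> faces M"

definition toroidal_map :: "('a, 'b) cmap \<Rightarrow> bool" where
  "toroidal_map M \<longleftrightarrow> combinatorial_map M \<and> euler_char M = 0"


section \<open>Homotopy\<close>

definition face_walk :: "('a, 'b) cmap \<Rightarrow> 'b \<Rightarrow> 'b list" where
  "face_walk M a = map (\<lambda>i. (face_succ M ^^ i) a) [0..<card (face_of M a)]"

text \<open>
  Homotopy, with fixed endpoints, of walks in a map: the equivalence relation generated by removing
  a backtracking step and by removing the boundary walk of a face.
\<close>

inductive homotopy_step :: "('a, 'b) cmap \<Rightarrow> 'b list \<Rightarrow> 'b list \<Rightarrow> bool"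
  for M :: "('a, 'b) cmap" where
  backtrack: "pre_digraph.awalk (graph M) u (p @ [a, opp M a] @ q) w \<Longrightarrow>
    homotopy_step M (p @ [a, opp M a] @ q) (p @ q)"
| face: "pre_digraph.awalk (graph M) u (p @ face_walk M a @ q) w \<Longrightarrow> a \<in> arcs (graph M) \<Longrightarrow>
    homotopy_step M (p @ face_walk M a @ q) (p @ q)"

definition homotopic_walks :: "('a, 'b) cmap \<Rightarrow> 'b list \<Rightarrow> 'b list \<Rightarrow> bool" where
  "homotopic_walks M = equivclp (homotopy_step M)"

definition contractible_loop :: "('a, 'b) cmap \<Rightarrow> 'b \<Rightarrow> bool" where
  "contractible_loop M l \<longleftrightarrow> homotopic_walks M [l] []"

text \<open>
  Loops, as edges, carry no orientation. On the torus it makes no difference whether the base point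
  is kept fixed, because the fundamental group is abelian.
\<close>

definition homotopic_loops :: "('a, 'b) cmap \<Rightarrow> 'b \<Rightarrow> 'b \<Rightarrow> bool" where
  "homotopic_loops M l l' \<longleftrightarrow> homotopic_walks M [l] [l'] \<or> homotopic_walks M [l] [opp M l']"


section \<open>Universal cover of a toroidal map\<close>

text \<open>
  Represent the torus by a parallelogram with opposite sides identified and tile the plane with
  copies of it, indexed by pairs of integers. An arc that leaves from the copy \<open>z\<close> arrives in the
  copy \<open>z + \<delta> a\<close>, where \<open>\<delta> a\<close> counts, with sign, how often \<open>a\<close> crosses the two pairs of sides. The
  displacement of a facial walk vanishes, because a face is a disk, and closed walks of the map
  realize all translations of the tiling. Conversely, these conditions identify the first homology
  group of the torus, which is its fundamental group, with the group of translations, so that they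
  determine the graph obtained below up to isomorphism.
\<close>

definition flat_representation :: "('a, 'b) cmap \<Rightarrow> ('b \<Rightarrow> int \<times> int) \<Rightarrow> bool" where
  "flat_representation M \<delta> \<longleftrightarrow>
     (\<forall>a \<in> arcs (graph M). \<delta> (opp M a) = - \<delta> a) \<and>
     (\<forall>f \<in> faces M. (\<Sum>a\<in>f. \<delta> a) = 0) \<and>
     (\<forall>u \<in> verts (graph M). \<forall>z. \<exists>p. pre_digraph.awalk (graph M) u p u \<and> sum_list (map \<delta> p) = z)"

definition universal_cover ::
  "('a, 'b) pre_digraph \<Rightarrow> ('b \<Rightarrow> int \<times> int) \<Rightarrow> ('a \<times> int \<times> int, 'b \<times> int \<times> int) pre_digraph" where
  "universal_cover G \<delta> =
     \<lparr> verts = verts G \<times> UNIV,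
       arcs = arcs G \<times> UNIV,
       tail = (\<lambda>(a, z). (tail G a, z)),
       head = (\<lambda>(a, z). (head G a, z + \<delta> a)) \<rparr>"

definition essentially_3_connected :: "('a, 'b) cmap \<Rightarrow> bool" where
  "essentially_3_connected M \<longleftrightarrow>
     toroidal_map M \<and>
     (\<exists>\<delta>. flat_representation M \<delta> \<and> k_connected 3 (universal_cover (graph M) \<delta>))"


section \<open>Adding a vertex\<close>

text \<open>
  The new vertex is \<open>None\<close>. \<open>Spoke i True\<close> is the arc from the new vertex to the \<open>i\<close>-th chosen
  vertex and \<open>Spoke i False\<close> is its reverse; \<open>Loop i True\<close> and \<open>Loop i False\<close> are the two
  orientations of the \<open>i\<close>-th loop at the new vertex.
\<close>

datatype 'b ext_arc = Old 'b | Spoke 3 bool | Loop 3 bool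

primrec ext_opp :: "('b \<Rightarrow> 'b) \<Rightarrow> 'b ext_arc \<Rightarrow> 'b ext_arc" where
  "ext_opp r (Old b) = Old (r b)"
| "ext_opp r (Spoke i out) = Spoke i (\<not> out)"
| "ext_opp r (Loop i d) = Loop i (\<not> d)"

primrec ext_tail :: "('a, 'b) pre_digraph \<Rightarrow> (3 \<Rightarrow> 'a) \<Rightarrow> 'b ext_arc \<Rightarrow> 'a option" where
  "ext_tail G x (Old b) = Some (tail G b)"
| "ext_tail G x (Spoke i out) = (if out then None else Some (x i))"
| "ext_tail G x (Loop i d) = None"

primrec ext_head :: "('a, 'b) pre_digraph \<Rightarrow> (3 \<Rightarrow> 'a) \<Rightarrow> 'b ext_arc \<Rightarrow> 'a option" where
  "ext_head G x (Old b) = Some (head G b)"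
| "ext_head G x (Spoke i out) = (if out then Some (x i) else None)"
| "ext_head G x (Loop i d) = None"

definition apex_graph ::
  "('a, 'b) pre_digraph \<Rightarrow> (3 \<Rightarrow> 'a) \<Rightarrow> ('a option, 'b ext_arc) pre_digraph" where
  "apex_graph G x =
     \<lparr> verts = insert None (Some ` verts G),
       arcs = Old ` arcs G \<union> {Spoke i out | i out. True},
       tail = ext_tail G x,
       head = ext_head G x \<rparr>"

definition apex_loops_graph ::
  "('a, 'b) pre_digraph \<Rightarrow> (3 \<Rightarrow> 'a) \<Rightarrow> ('a option, 'b ext_arc) pre_digraph" where
  "apex_loops_graph G x =
     \<lparr> verts = insert None (Some ` verts G),
       arcs = Old ` arcs G \<union> {Spoke i out | i out. True} \<union> {Loop i d | i d. True},
       tail = ext_tail G x,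
       head = ext_head G x \<rparr>"

definition internally_3_connected :: "('a, 'b) cmap \<Rightarrow> 'b set \<Rightarrow> bool" where
  "internally_3_connected M f \<longleftrightarrow>
     (\<exists>x :: 3 \<Rightarrow> 'a. inj x \<and> range x \<subseteq> face_verts M f \<and> k_connected 3 (apex_graph (graph M) x))"


section \<open>The toroidal map obtained from a planar map\<close>

text \<open>
  An arc \<open>b\<close> of the face \<open>f\<close> stands for the corner of \<open>f\<close> immediately before \<open>b\<close> in
  counterclockwise order around the tail of \<open>b\<close>. A vertex may have several corners in \<open>f\<close>.
\<close>

definition ccw_corners :: "('a, 'b) cmap \<Rightarrow> 'b set \<Rightarrow> (3 \<Rightarrow> 'a) \<Rightarrow> (3 \<Rightarrow> 'b) \<Rightarrow> bool" where
  "ccw_corners M f x c \<longleftrightarrow>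
     range c \<subseteq> f \<and> (\<forall>i. tail (graph M) (c i) = x i) \<and>
     (\<exists>m n. 0 < m \<and> m < n \<and> n < card f \<and>
        c 1 = (face_succ M ^^ m) (c 0) \<and> c 2 = (face_succ M ^^ n) (c 0))"

text \<open>
  \<open>is_plus_map M f x T\<close>: the toroidal map \<open>T\<close> arises from the planar map \<open>M\<close> with outer face \<open>f\<close>
  and the vertices \<open>x 0\<close>, \<open>x 1\<close>, \<open>x 2\<close>, in counterclockwise order on \<open>f\<close>. At the vertices of \<open>M\<close>
  the rotation is that of \<open>M\<close>, with a spoke inserted into a corner of \<open>f\<close> at each \<open>x i\<close>.
\<close>

definition is_plus_map ::
  "('a, 'b) cmap \<Rightarrow> 'b set \<Rightarrow> (3 \<Rightarrow> 'a) \<Rightarrow> ('a option, 'b ext_arc) cmap \<Rightarrow> bool" where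
  "is_plus_map M f x T \<longleftrightarrow>
     toroidal_map T \<and>
     graph T = apex_loops_graph (graph M) x \<and>
     opp T = ext_opp (opp M) \<and>
     (\<exists>c. ccw_corners M f x c \<and>
        (\<forall>a \<in> arcs (graph M). rot M a \<notin> range c \<longrightarrow> rot T (Old a) = Old (rot M a)) \<and>
        (\<forall>a \<in> arcs (graph M). \<forall>i. rot M a = c i \<longrightarrow> rot T (Old a) = Spoke i False) \<and>
        (\<forall>i. rot T (Spoke i False) = Old (c i))) \<and>
     (\<forall>i j. rot T (Spoke i True) \<noteq> Spoke j True) \<and>
     (\<forall>i. \<not> contractible_loop T (Loop i True)) \<and>
     (\<forall>i j. i \<noteq> j \<longrightarrow> \<not> homotopic_loops T (Loop i True) (Loop j True))"

end

(* A planar map with three chosen outer vertices X becomes 3-connected after adding a vertex adjacent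
   to X iff every nonempty union D of components of G - S satisfies |S| + |D \<inter> X| >= 3. The same
   condition characterizes 3-connectivity of the universal cover of the toroidal map: the copies of the
   new vertex form a triangular lattice, which deleting two points does not disconnect, and three of
   them are attached to each copy of G. Conversely, D lifts to the cover and is cut off there by the
   lift of S together with |D \<inter> X| copies of the new vertex. Lifting requires the displacements to be
   trivial on G. They vanish on all faces of G, and the first cohomology of the sphere is zero. *)

theory Submission
  imports Defs
begin

section \<open>Connectivity by closed vertex sets\<close>

text \<open>The criterion works for the cover because a cut by fewer than three vertices can be
  judged in one copy of \<open>G\<close> at a time: only the deleted vertices of that copy and the
  three lattice points around it matter. In the other direction the toroidal map and its
  displacements are arbitrary. The obstacle there is a closed walk of \<open>G\<close> with nonzero
  displacement: \<open>D\<close> could then unroll to an infinite set with infinitely many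
  attachments, and no finite cut would appear. A potential on the vertices of \<open>G\<close>
  excludes this, since it selects one copy of every vertex so that the arcs of \<open>G\<close> join
  selected copies to selected copies. It is read off a spanning tree of the map whose complement is
  a spanning tree of the dual. Displacements also serve as a homotopy invariant: their sum along a
  walk survives both kinds of homotopy step. Hence three explicit integer vectors settle all
  requirements on the loops of the constructed map.\<close>

definition closed_within :: "('a, 'b) pre_digraph \<Rightarrow> 'a set \<Rightarrow> 'a set \<Rightarrow> bool" where
  "closed_within G W C \<longleftrightarrow>
     (\<forall>a \<in> arcs G. tail G a \<in> W \<and> head G a \<in> W \<longrightarrow> (tail G a \<in> C \<longleftrightarrow> head G a \<in> C))"

lemma closed_withinD:
  "closed_within G W C \<Longrightarrow> a \<in> arcs G \<Longrightarrow> tail G a \<in> W \<Longrightarrow> head G a \<in> W \<Longrightarrow>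
    tail G a \<in> C \<longleftrightarrow> head G a \<in> C"
  by (simp add: closed_within_def)

lemma closed_within_Compl: "closed_within G W C \<Longrightarrow> closed_within G W (W - C)"
  by (auto simp: closed_within_def)

text \<open>The set of vertices reachable from a vertex is closed, and a closed set contains
  whatever is reachable from one of its members. Connectivity thus becomes a statement about sets
  with no crossing arc, so that later arguments never have to route paths around deleted
  vertices.\<close>

lemma connected_iff_closed:
  "connected G \<longleftrightarrow> verts G \<noteq> {} \<and>
     (\<forall>C \<subseteq> verts G. C \<noteq> {} \<and> closed_within G (verts G) C \<longrightarrow> C = verts G)"
    (is "_ \<longleftrightarrow> _ \<and> ?R")
proof -
  let ?r = "rtrancl_on (verts G) ((arcs_ends G)\<^sup>s)"
  have sym: "(u, v) \<in> (arcs_ends G)\<^sup>s \<longleftrightarrow>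
      (\<exists>a \<in> arcs G. (u = tail G a \<and> v = head G a) \<or> (v = tail G a \<and> u = head G a))" for u v
    by (auto simp: symcl_def arcs_ends_def arc_to_ends_def)
  have "(\<forall>u \<in> verts G. \<forall>v \<in> verts G. (u, v) \<in> ?r) \<longleftrightarrow> ?R"
  proof
    assume conn: "\<forall>u \<in> verts G. \<forall>v \<in> verts G. (u, v) \<in> ?r"
    show ?R
    proof (intro allI impI, elim conjE)
      fix C assume C: "C \<subseteq> verts G" "C \<noteq> {}" "closed_within G (verts G) C"
      obtain u where u: "u \<in> C" using C by blast
      have "v \<in> C" if "v \<in> verts G" for v
      proof -
        have "(u, v) \<in> ?r" using conn u C that by blast
        then show ?thesis
        proof (induction rule: rtrancl_on_induct)
          case (step y z)
          then show ?case using C(3) by (auto simp: sym closed_within_def)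
        qed (rule u)
      qed
      then show "C = verts G" using C by blast
    qed
  next
    assume R: ?R
    show "\<forall>u \<in> verts G. \<forall>v \<in> verts G. (u, v) \<in> ?r"
    proof
      fix u assume u: "u \<in> verts G"
      let ?C = "{v \<in> verts G. (u, v) \<in> ?r}"
      have step: "(u, w) \<in> ?r" if "(u, v) \<in> ?r" "(v, w) \<in> (arcs_ends G)\<^sup>s" "w \<in> verts G" for v w
        using that by (rule rtrancl_on_into_rtrancl_on)
      have "?C \<subseteq> verts G" by blast
      moreover have "?C \<noteq> {}" using u rtrancl_on_refl by fast
      moreover have "closed_within G (verts G) ?C"
        unfolding closed_within_def
      proof (intro ballI impI)
        fix a assume a: "a \<in> arcs G" "tail G a \<in> verts G \<and> head G a \<in> verts G"
        then have "(tail G a, head G a) \<in> (arcs_ends G)\<^sup>s" "(head G a, tail G a) \<in> (arcs_ends G)\<^sup>s"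
          unfolding sym by blast+
        then show "tail G a \<in> ?C \<longleftrightarrow> head G a \<in> ?C"
          using a(2) step[of "tail G a"] step[of "head G a"] by blast
      qed
      ultimately have "?C = verts G" by (rule R[rule_format, OF _ conjI])
      then show "\<forall>v \<in> verts G. (u, v) \<in> ?r" by blast
    qed
  qed
  then show ?thesis by (simp add: connected_conv)
qed

lemma connected_induce_iff_closed:
  "connected (G \<restriction> W) \<longleftrightarrow> W \<noteq> {} \<and>
     (\<forall>C \<subseteq> W. C \<noteq> {} \<and> closed_within G W C \<longrightarrow> C = W)"
proof -
  have "closed_within (G \<restriction> W) W C \<longleftrightarrow> closed_within G W C" for C
    by (auto simp: closed_within_def)
  then show ?thesis by (simp add: connected_iff_closed)
qed


section \<open>Connectivity after adding an apex vertex\<close>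

text \<open>
  \<open>X\<close> is the set of neighbours of the new vertex. Deleting \<open>S\<close> and the new vertex's copies adjacent
  to \<open>D\<close> separates \<open>D\<close>, both in the graph with one new vertex and in the universal cover of the
  toroidal map.
\<close>

definition apex_3_connected :: "('a, 'b) pre_digraph \<Rightarrow> 'a set \<Rightarrow> bool" where
  "apex_3_connected G X \<longleftrightarrow>
     (\<forall>S D. S \<subseteq> verts G \<and> D \<subseteq> verts G - S \<and> D \<noteq> {} \<and> closed_within G (verts G - S) D \<longrightarrow>
        3 \<le> card S + card (D \<inter> X))"

lemma exhaust_three: "(i :: 3) = 0 \<or> i = 1 \<or> i = 2"
proof (induct i)
  case (of_int z)
  then have "z = 0 \<or> z = 1 \<or> z = 2" by auto
  then show ?case by auto
qed

lemma card_range_three: "inj (x :: 3 \<Rightarrow> 'a) \<Longrightarrow> card (range x) = 3"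
  by (simp add: card_image)

lemma apex_graph_simps [simp]:
  "verts (apex_graph G x) = insert None (Some ` verts G)"
  "tail (apex_graph G x) = ext_tail G x"
  "head (apex_graph G x) = ext_head G x"
  "arcs (apex_graph G x) = Old ` arcs G \<union> {Spoke i out | i out. True}"
  by (simp_all add: apex_graph_def)

lemma closed_within_Some:
  assumes "\<And>a. a \<in> arcs G \<Longrightarrow> Old a \<in> arcs H"
    and "tail H = ext_tail G x" "head H = ext_head G x"
    and "closed_within H W C"
  shows "closed_within G {u. Some u \<in> W} {u. Some u \<in> C}"
  unfolding closed_within_def
  using assms(1) closed_withinD[OF assms(4), unfolded assms(2,3), of "Old a" for a] by force

lemma k_connected_apex_iff:
  assumes fin: "finite (verts G)" and x: "inj x" "range x \<subseteq> verts G"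
  shows "k_connected 3 (apex_graph G x) \<longleftrightarrow> apex_3_connected G (range x)"
proof -
  let ?A = "apex_graph G x" and ?V = "verts G" and ?X = "range x"
  have X3: "card ?X = 3" and finX: "finite ?X" using card_range_three[OF x(1)] by simp_all
  have card_minus: "3 \<le> card S + card (?X - S)" if "S \<subseteq> ?V" for S
  proof -
    have "card ?X \<le> card (S \<union> (?X - S))"
      using that fin finX by (intro card_mono) (auto intro: finite_subset)
    also have "\<dots> \<le> card S + card (?X - S)" by (rule card_Un_le)
    finally show ?thesis using X3 by simp
  qed
  show ?thesis
  proof
    assume conn: "k_connected 3 ?A"
    have conn': "connected (?A \<restriction> (verts ?A - Q))" if "Q \<subseteq> verts ?A" "card Q < 3" for Q
      using conn that fin unfolding k_connected_def
      by (metis apex_graph_simps(1) finite.insertI finite_imageI finite_subset)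
    show "apex_3_connected G ?X"
      unfolding apex_3_connected_def
    proof (intro allI impI, elim conjE)
      fix S D assume S: "S \<subseteq> ?V" and D: "D \<subseteq> ?V - S" "D \<noteq> {}" "closed_within G (?V - S) D"
      have finS: "finite S" using S fin by (rule finite_subset)
      show "3 \<le> card S + card (D \<inter> ?X)"
      \<comment> \<open>With at most one vertex in \<open>S\<close>, the new vertex can be deleted
        too, and connectivity forces \<open>D\<close> to be all that is left. With two or more, a
        violation would mean that \<open>D\<close> contains no neighbour of the new vertex, so
        \<open>S\<close> alone would cut \<open>D\<close> off from it.\<close>
      proof (cases "card S \<le> 1")
        case True
        let ?Q = "insert None (Some ` S)"
        have "card ?Q < 3" using True finS by (simp add: card_image)
        then have "connected (?A \<restriction> (verts ?A - ?Q))" using S by (intro conn') auto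
        moreover have "Some ` D \<subseteq> verts ?A - ?Q" "Some ` D \<noteq> {}" using D by auto
        moreover have "closed_within ?A (verts ?A - ?Q) (Some ` D)"
          using D(3) unfolding closed_within_def by (auto split: if_splits)
        ultimately have "Some ` D = verts ?A - ?Q" unfolding connected_induce_iff_closed by blast
        also have "\<dots> = Some ` (?V - S)" by auto
        finally have "D = ?V - S" by (auto simp: inj_image_eq_iff)
        then have "D \<inter> ?X = ?X - S" using x by auto
        then show ?thesis using card_minus[OF S] by simp
      next
        case False
        show ?thesis
        proof (rule ccontr)
          assume *: "\<not> 3 \<le> card S + card (D \<inter> ?X)"
          then have "card (D \<inter> ?X) = 0" using False by linarith
          then have DX: "D \<inter> ?X = {}" using finX by (metis card_0_eq finite_Int)
          then have DX': "x i \<notin> D" for i by auto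
          let ?Q = "Some ` S"
          have "card ?Q < 3" using * by (simp add: card_image)
          then have "connected (?A \<restriction> (verts ?A - ?Q))" using S by (intro conn') auto
          moreover have "Some ` D \<subseteq> verts ?A - ?Q" "Some ` D \<noteq> {}" using D by auto
          moreover have "closed_within ?A (verts ?A - ?Q) (Some ` D)"
            using D(3) DX' unfolding closed_within_def by (auto split: if_splits)
          ultimately have "Some ` D = verts ?A - ?Q" unfolding connected_induce_iff_closed by blast
          then show False by auto
        qed
      qed
    qed
  next
    assume sep: "apex_3_connected G ?X"
    have sepD: "3 \<le> card S + card (D \<inter> ?X)"
      if "S \<subseteq> ?V" "D \<subseteq> ?V - S" "D \<noteq> {}" "closed_within G (?V - S) D" for S D
      using sep that unfolding apex_3_connected_def by blast
    have "3 \<le> card ?V" using card_mono[OF fin x(2)] X3 by simp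
    then have "3 < card (verts ?A)" using fin by (simp add: card_image)
    moreover have "connected (?A \<restriction> (verts ?A - Q))"
      if Q: "Q \<subseteq> verts ?A" "card Q < 3" for Q
      unfolding connected_induce_iff_closed
    proof (intro conjI allI impI)
      let ?W = "verts ?A - Q" and ?S = "{u. Some u \<in> Q}"
      have finQ: "finite Q" using Q(1) fin by (auto intro: finite_subset)
      show "?W \<noteq> {}"
      proof
        assume "?W = {}"
        then have "card (verts ?A) \<le> card Q" using finQ by (intro card_mono) auto
        then show False using Q(2) \<open>3 < card (verts ?A)\<close> by simp
      qed
      fix C assume "C \<subseteq> ?W" and C': "C \<noteq> {} \<and> closed_within ?A ?W C"
      have S: "?S \<subseteq> ?V" using Q(1) by auto
      have SQ: "Some ` ?S = Q - {None}" by (auto simp: image_iff) (metis not_None_eq)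
      then have cardS: "card ?S = card (Q - {None})" by (metis card_image inj_Some)
      have W: "{u. Some u \<in> ?W} = ?V - ?S" by auto
      have closedG: "closed_within G (?V - ?S) {u. Some u \<in> B}" if "closed_within ?A ?W B" for B
        using closed_within_Some[of G ?A x, OF _ _ _ that] W by simp
      have attached: "3 \<le> card ?S + card ({u. Some u \<in> B} \<inter> ?X)"
        if "B \<subseteq> ?W" "closed_within ?A ?W B" "B - {None} \<noteq> {}" for B
      proof (rule sepD[OF S _ _ closedG[OF that(2)]])
        show "{u. Some u \<in> B} \<subseteq> ?V - ?S" using that(1) by auto
        show "{u. Some u \<in> B} \<noteq> {}" using that(3) by (auto) (metis not_None_eq)
      qed
      show "C = ?W"
      \<comment> \<open>If the new vertex survives, the side not containing it has no vertex of
        \<open>?X\<close>, so \<open>?S\<close> alone would need three elements. If it is deleted,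
        \<open>?S\<close> has at most one element, and each of the two sides would claim at least
        two of the three elements of \<open>?X\<close>.\<close>
      proof (cases "None \<in> Q")
        case False
        have empty: "B = {}" if B: "B \<subseteq> ?W" "closed_within ?A ?W B" "None \<notin> B" for B
        proof (rule ccontr)
          assume "B \<noteq> {}"
          then have "3 \<le> card ?S + card ({u. Some u \<in> B} \<inter> ?X)" using B by (intro attached) auto
          moreover have "{u. Some u \<in> B} \<inter> ?X = {}"
          proof (rule ccontr)
            assume "{u. Some u \<in> B} \<inter> ?X \<noteq> {}"
            then obtain i where "Some (x i) \<in> B" by auto
            then show False
              using closed_withinD[OF B(2), of "Spoke i True"] B False by auto
          qed
          ultimately show False using cardS Q(2) False by simp
        qed
        show ?thesis
        proof (cases "None \<in> C")
          case True
          then have "?W - C = {}"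
            using C' by (intro empty closed_within_Compl) auto
          then show ?thesis using \<open>C \<subseteq> ?W\<close> by blast
        next
          case False
          then show ?thesis using empty[of C] \<open>C \<subseteq> ?W\<close> C' by blast
        qed
      next
        case True
        show ?thesis
        proof (rule ccontr)
          assume "C \<noteq> ?W"
          let ?C1 = "{u. Some u \<in> C} \<inter> ?X" and ?C2 = "{u. Some u \<in> ?W - C} \<inter> ?X"
          have "3 \<le> card ?S + card ?C1"
            using C' \<open>C \<subseteq> ?W\<close> True by (intro attached) auto
          moreover have "3 \<le> card ?S + card ?C2"
            using C' \<open>C \<subseteq> ?W\<close> True \<open>C \<noteq> ?W\<close> by (intro attached closed_within_Compl) auto
          moreover have "card ?C1 + card ?C2 = card (?C1 \<union> ?C2)"
            using finX by (intro card_Un_disjoint[symmetric]) auto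
          moreover have "card (?C1 \<union> ?C2) \<le> card ?X" using finX by (intro card_mono) auto
          moreover have "card ?S < 2" using cardS Q(2) True finQ by simp
          ultimately show False using X3 by linarith
        qed
      qed
    qed
    ultimately show "k_connected 3 ?A" unfolding k_connected_def by blast
  qed
qed


section \<open>Planar maps have no cohomology\<close>

text \<open>The arc set is a parameter because trees are grown twice: for the dual map on all arcs,
  and for the map itself on the arcs that the dual tree leaves over.\<close>

locale symmetric_arcs =
  fixes I :: "'e set" and r :: "'e \<Rightarrow> 'e"
  assumes finite_I: "finite I"
    and r_in: "e \<in> I \<Longrightarrow> r e \<in> I"
    and r_r: "e \<in> I \<Longrightarrow> r (r e) = e"
begin

text \<open>
  The arc \<open>e\<close> runs from \<open>s e\<close> to \<open>s (r e)\<close>. Taking for \<open>s\<close> the tail of an arc gives trees of a map,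
  taking for \<open>s\<close> the face of an arc gives trees of the dual map.
\<close>

inductive grown_tree :: "('e \<Rightarrow> 'w) \<Rightarrow> 'w set \<Rightarrow> 'e set \<Rightarrow> bool" for s where
  single: "grown_tree s {w} {}"
| extend: "grown_tree s W J \<Longrightarrow> e \<in> I \<Longrightarrow> s e \<in> W \<Longrightarrow> s (r e) \<notin> W \<Longrightarrow>
    grown_tree s (insert (s (r e)) W) (insert e (insert (r e) J))"

text \<open>The last equation is the edge count of a tree, with every edge counted as two
  arcs.\<close>

lemma grown_tree_props:
  assumes "grown_tree s W J"
  shows "finite W" "J \<subseteq> I" "s ` J \<subseteq> W" "r ` J \<subseteq> J" "card J + 2 = 2 * card W"
proof -
  have "finite W \<and> J \<subseteq> I \<and> s ` J \<subseteq> W \<and> r ` J \<subseteq> J \<and> card J + 2 = 2 * card W"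
    using assms
  proof induction
    case (extend W J e)
    then have "finite J" using finite_I finite_subset by blast
    moreover have "r e \<notin> J" "e \<notin> J" "e \<noteq> r e" using extend r_r by force+
    ultimately show ?case using extend r_in r_r by auto
  qed auto
  then show "finite W" "J \<subseteq> I" "s ` J \<subseteq> W" "r ` J \<subseteq> J" "card J + 2 = 2 * card W" by auto
qed

lemma grown_tree_potential:
  fixes \<delta> :: "'e \<Rightarrow> 'g :: ab_group_add"
  assumes "grown_tree s W J" and anti: "\<And>e. e \<in> I \<Longrightarrow> \<delta> (r e) = - \<delta> e"
  shows "\<exists>\<phi>. \<forall>e \<in> J. \<delta> e = \<phi> (s (r e)) - \<phi> (s e)"
  using assms(1)
proof induction
  case (extend W J e)
  obtain \<phi> where \<phi>: "\<And>a. a \<in> J \<Longrightarrow> \<delta> a = \<phi> (s (r a)) - \<phi> (s a)" using extend.IH by blast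
  let ?\<psi> = "\<phi>(s (r e) := \<phi> (s e) + \<delta> e)"
  have J: "s a \<in> W" "s (r a) \<in> W" if "a \<in> J" for a
    using grown_tree_props(3,4)[OF extend.hyps(1)] that by (auto simp: image_subset_iff)
  have "\<delta> a = ?\<psi> (s (r a)) - ?\<psi> (s a)" if "a \<in> insert e (insert (r e) J)" for a
    using that
  proof (elim insertE)
    assume "a = e"
    then show ?thesis using extend.hyps by auto
  next
    assume "a = r e"
    then show ?thesis using extend.hyps anti r_r by auto
  next
    assume "a \<in> J"
    then show ?thesis using \<phi> J extend.hyps by (metis fun_upd_apply)
  qed
  then show ?case by blast
qed auto

text \<open>Strip the leaves in reverse order of attachment. At the last leaf \<open>s (r a)\<close>
  only \<open>r a\<close> can carry a nonzero value, so conservation at the leaf makes it zero, and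
  antisymmetry does the same for \<open>a\<close>.\<close>

lemma grown_tree_flow_zero:
  fixes g :: "'e \<Rightarrow> 'g :: ab_group_add"
  assumes "grown_tree s W J" and anti: "\<And>e. e \<in> I \<Longrightarrow> g (r e) = - g e"
    and "\<And>e. e \<in> I - J \<Longrightarrow> g e = 0"
    and "\<And>w. w \<in> W \<Longrightarrow> (\<Sum>e | e \<in> I \<and> s e = w. g e) = 0"
    and "e \<in> I"
  shows "g e = 0"
  using assms(1,3-)
proof (induction arbitrary: e)
  case (extend W J a)
  have J: "s b \<in> W" if "b \<in> J" for b
    using grown_tree_props[OF extend.hyps(1)] that by auto
  have "0 = (\<Sum>b | b \<in> I \<and> s b = s (r a). g b)" using extend.prems(2) by simp
  also have "\<dots> = (\<Sum>b \<in> {r a}. g b)"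
  proof (rule sum.mono_neutral_right)
    show "\<forall>b \<in> {b \<in> I. s b = s (r a)} - {r a}. g b = 0"
    proof
      fix b assume b: "b \<in> {b \<in> I. s b = s (r a)} - {r a}"
      then have "b \<noteq> a" "b \<notin> J" using extend.hyps(3,4) J[of b] by auto
      then show "g b = 0" using b by (intro extend.prems(1)) auto
    qed
  qed (use finite_I r_in extend.hyps in auto)
  finally have "g (r a) = 0" by simp
  moreover from this have "g a = 0" using anti extend.hyps(2) by simp
  ultimately have "g b = 0" if "b \<in> I - J" for b using that extend.prems(1) by blast
  then show ?case using extend.IH extend.prems by blast
qed auto

text \<open>A maximal subset of \<open>W\<close> that carries a tree is \<open>W\<close> itself, as
  a crossing arc would extend the tree.\<close>

lemma grown_tree_exists:
  assumes "finite W" "W \<noteq> {}"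
    and crossing: "\<And>C. C \<subseteq> W \<Longrightarrow> C \<noteq> {} \<Longrightarrow> C \<noteq> W \<Longrightarrow> \<exists>e \<in> I. s e \<in> C \<and> s (r e) \<in> W - C"
  shows "\<exists>J. grown_tree s W J"
proof -
  define T where "T = {C. C \<subseteq> W \<and> (\<exists>J. grown_tree s C J)}"
  obtain w where "w \<in> W" using assms by blast
  then have "{w} \<in> T" unfolding T_def by (auto intro: single)
  moreover have "finite T" using assms(1) by (simp add: T_def)
  ultimately obtain C where "C \<in> T" and max: "\<And>B. B \<in> T \<Longrightarrow> C \<subseteq> B \<Longrightarrow> C = B"
    using finite_has_maximal[of T] by blast
  then have C: "C \<subseteq> W" "\<exists>J. grown_tree s C J" unfolding T_def by simp_all
  obtain J where J: "grown_tree s C J" using C by blast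
  have "C \<noteq> {}" using J by (rule grown_tree.cases) auto
  have "C = W"
  proof (rule ccontr)
    assume "C \<noteq> W"
    then obtain e where e: "e \<in> I" "s e \<in> C" "s (r e) \<in> W - C"
      using crossing[OF C(1) \<open>C \<noteq> {}\<close>] by blast
    then have "insert (s (r e)) C \<in> T" using extend[OF J e(1,2)] C unfolding T_def by blast
    then show False using max e(3) by blast
  qed
  then show ?thesis using J by blast
qed

end

section \<open>Faces and rotations of a combinatorial map\<close>

lemma (in combinatorial_map) face_succ_permutes: "face_succ M permutes arcs (graph M)"
  unfolding face_succ_def by (intro permutes_compose rot_permutes arev_permutes_arcs)

lemma (in combinatorial_map) face_of_self: "a \<in> face_of M a"
  unfolding face_of_def
  using face_succ_permutes finite_arcs permutation_permutes permutation_self_in_orbit by metis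

lemma (in combinatorial_map) face_of_subset: "a \<in> arcs (graph M) \<Longrightarrow> face_of M a \<subseteq> arcs (graph M)"
  unfolding face_of_def by (rule permutes_orbit_subset[OF face_succ_permutes])

lemma (in combinatorial_map) face_of_cyclic: "cyclic_on (face_succ M) (face_of M a)"
  unfolding face_of_def using face_succ_permutes finite_arcs by (rule cyclic_on_orbit)

lemma (in combinatorial_map) face_of_eq: "b \<in> face_of M a \<Longrightarrow> face_of M b = face_of M a"
  using face_of_cyclic[of a] unfolding cyclic_on_alldef by (auto simp: face_of_def)

lemma (in combinatorial_map) face_succ_in_face: "b \<in> face_of M a \<Longrightarrow> face_succ M b \<in> face_of M a"
  unfolding face_of_def by (rule orbit.step)

lemma (in combinatorial_map) face_of_face_succ: "face_of M (face_succ M a) = face_of M a"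
  by (intro face_of_eq face_succ_in_face face_of_self)

lemma (in combinatorial_map) faces_eq:
  "arcs (graph M) \<noteq> {} \<Longrightarrow> faces M = face_of M ` arcs (graph M)"
  by (simp add: faces_def)

lemma (in combinatorial_map) arcs_of_face:
  assumes "arcs (graph M) \<noteq> {}" "g \<in> faces M"
  shows "{a. a \<in> arcs (graph M) \<and> face_of M a = g} = g"
proof -
  obtain b where "b \<in> arcs (graph M)" "g = face_of M b"
    using assms by (auto simp: faces_eq)
  then show ?thesis using face_of_self face_of_eq face_of_subset[of b] by auto
qed

lemma (in combinatorial_map) arcs_symmetric: "symmetric_arcs (arcs (graph M)) (opp M)"
  by unfold_locales auto

lemma (in combinatorial_map) rot_eq: "rot M a = face_succ M (opp M a)"
  by (simp add: face_succ_def)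

lemma (in combinatorial_map) cyclic_on_rot:
  assumes "a \<in> arcs (graph M)"
  shows "cyclic_on (rot M) (out_arcs (graph M) (tail (graph M) a))"
proof (rule rot_cyclic)
  have "a \<in> out_arcs (graph M) (tail (graph M) a)" using assms by simp
  then show "out_arcs (graph M) (tail (graph M) a) \<noteq> {}" by blast
qed (use assms in simp)

lemma (in combinatorial_map) tail_rot:
  assumes "a \<in> arcs (graph M)"
  shows "tail (graph M) (rot M a) = tail (graph M) a"
  using cyclic_on_inI[OF cyclic_on_rot[OF assms], of a] assms by simp

lemma (in combinatorial_map) tail_face_succ:
  "a \<in> arcs (graph M) \<Longrightarrow> tail (graph M) (face_succ M a) = head (graph M) a"
  by (simp add: face_succ_def tail_rot)

lemma (in combinatorial_map) rot_closed_out_arcs: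
  assumes "A \<subseteq> arcs (graph M)" "\<And>a. a \<in> A \<Longrightarrow> rot M a \<in> A" "a \<in> A"
  shows "out_arcs (graph M) (tail (graph M) a) \<subseteq> A"
proof -
  let ?u = "tail (graph M) a"
  have "a \<in> out_arcs (graph M) ?u" using assms by auto
  then have "out_arcs (graph M) ?u = orbit (rot M) a"
    using cyclic_on_rot[of a] unfolding cyclic_on_alldef by auto
  also have "\<dots> \<subseteq> A"
  proof
    fix b assume "b \<in> orbit (rot M) a"
    then show "b \<in> A" by induction (simp_all add: assms(2,3))
  qed
  finally show ?thesis .
qed

text \<open>Closure from tails to heads is enough: applied to the reverse arc it gives the other
  direction.\<close>

lemma (in combinatorial_map) no_proper_closed:
  assumes "C \<subseteq> verts (graph M)" "C \<noteq> {}"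
    and "\<And>a. a \<in> arcs (graph M) \<Longrightarrow> tail (graph M) a \<in> C \<Longrightarrow> head (graph M) a \<in> C"
  shows "C = verts (graph M)"
proof -
  have "closed_within (graph M) (verts (graph M)) C"
    unfolding closed_within_def
  proof (intro ballI impI)
    fix a assume "a \<in> arcs (graph M)"
    then show "tail (graph M) a \<in> C \<longleftrightarrow> head (graph M) a \<in> C"
      using assms(3)[of a] assms(3)[of "opp M a"] by auto
  qed
  then show ?thesis
    by (intro map_connected[unfolded connected_iff_closed, THEN conjunct2, rule_format] conjI
        assms(1,2))
qed

text \<open>
  The complement of a spanning tree of the dual map is connected: the coboundary of a vertex set
  that it does not cross is a flow supported on the dual tree. By Euler's formula this complement
  is a spanning tree of the map.
\<close>

theorem (in combinatorial_map) planar_potential: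
  fixes \<delta> :: "'b \<Rightarrow> 'g :: ab_group_add"
  assumes euler: "euler_char M = 2" and ne: "arcs (graph M) \<noteq> {}"
    and anti: "\<And>a. a \<in> arcs (graph M) \<Longrightarrow> \<delta> (opp M a) = - \<delta> a"
    and faces: "\<And>g. g \<in> faces M \<Longrightarrow> sum \<delta> g = 0"
  shows "\<exists>\<phi>. \<forall>a \<in> arcs (graph M). \<delta> a = \<phi> (head (graph M) a) - \<phi> (tail (graph M) a)"
proof -
  let ?I = "arcs (graph M)" and ?V = "verts (graph M)"
  interpret symmetric_arcs ?I "opp M" by (rule arcs_symmetric)
  have "\<exists>J. grown_tree (face_of M) (faces M) J"
  proof (rule grown_tree_exists)
    show "finite (faces M)" "faces M \<noteq> {}" using ne by (simp_all add: faces_eq)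
    fix \<Phi> assume \<Phi>: "\<Phi> \<subseteq> faces M" "\<Phi> \<noteq> {}" "\<Phi> \<noteq> faces M"
    show "\<exists>e \<in> ?I. face_of M e \<in> \<Phi> \<and> face_of M (opp M e) \<in> faces M - \<Phi>"
    proof (rule ccontr)
      assume no: "\<not> ?thesis"
      \<comment> \<open>If no edge leads out of \<open>\<Phi>\<close>, then \<open>A\<close> is
        closed under \<open>opp M\<close> and \<open>face_succ M\<close>, hence under
        \<open>rot M\<close>. So it contains every arc at each vertex that it touches, and by
        connectivity all arcs. This is the connectedness of the dual map.\<close>
      define A where "A = {a \<in> ?I. face_of M a \<in> \<Phi>}"
      have opp_A: "opp M a \<in> A" if "a \<in> A" for a
        using no that unfolding A_def faces_eq[OF ne] by simp
      have "face_succ M a \<in> A" if "a \<in> A" for a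
        using that face_succ_permutes unfolding A_def
        by (simp add: face_of_face_succ permutes_in_image)
      then have rot_A: "rot M a \<in> A" if "a \<in> A" for a
        using that opp_A by (simp add: rot_eq)
      have "A \<noteq> {}" using \<Phi> unfolding A_def by (auto simp: faces_eq[OF ne])
      have A: "A \<subseteq> ?I" by (auto simp: A_def)
      have out: "b \<in> A" if "a \<in> A" "b \<in> ?I" "tail (graph M) b = tail (graph M) a" for a b
        using rot_closed_out_arcs[OF A rot_A that(1)] that by auto
      have "tail (graph M) ` A = ?V"
      proof (rule no_proper_closed)
        fix a assume a: "a \<in> ?I" "tail (graph M) a \<in> tail (graph M) ` A"
        then have "a \<in> A" using out by auto
        then have "opp M a \<in> A" by (rule opp_A)
        then show "head (graph M) a \<in> tail (graph M) ` A" using a(1) by force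
      qed (use A \<open>A \<noteq> {}\<close> in auto)
      then have "b \<in> A" if "b \<in> ?I" for b
      proof -
        have "tail (graph M) b \<in> tail (graph M) ` A"
          using \<open>tail (graph M) ` A = ?V\<close> that by simp
        then obtain a where "a \<in> A" "tail (graph M) b = tail (graph M) a" by blast
        then show ?thesis using out that by blast
      qed
      then have "?I \<subseteq> A" by blast
      then have "faces M \<subseteq> \<Phi>" unfolding faces_eq[OF ne] by (auto simp: A_def)
      then show False using \<Phi> by blast
    qed
  qed
  then obtain T where T: "grown_tree (face_of M) (faces M) T" ..
  \<comment> \<open>Polymorphic in the group, because it is applied to an integer coboundary and
    later to an error term with values in \<open>'g\<close>.\<close>
  have dual_zero: "g a = 0"
    if "\<And>a. a \<in> ?I \<Longrightarrow> g (opp M a) = - g a" "\<And>a. a \<in> ?I - T \<Longrightarrow> g a = 0"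
      "\<And>f. f \<in> faces M \<Longrightarrow> sum g f = 0" "a \<in> ?I" for g :: "'b \<Rightarrow> 'h :: ab_group_add" and a
  proof (rule grown_tree_flow_zero[OF T])
    show "(\<Sum>e | e \<in> ?I \<and> face_of M e = f. g e) = 0" if "f \<in> faces M" for f
      unfolding arcs_of_face[OF ne that] using \<open>f \<in> faces M\<close> by fact
  qed (use that in auto)
  have coboundary: "sum (\<lambda>a. \<phi> (head (graph M) a) - \<phi> (tail (graph M) a)) f = 0"
    if f: "f \<in> faces M" for f and \<phi> :: "'a \<Rightarrow> 'h :: ab_group_add"
  proof -
    obtain a where a: "a \<in> ?I" "f = face_of M a" using f by (auto simp: faces_eq[OF ne])
    have fI: "f \<subseteq> ?I" using a face_of_subset by simp
    have bij: "bij_betw (face_succ M) f f"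
    proof (rule bij_betw_imageI)
      show "inj_on (face_succ M) f" by (rule permutes_inj_on[OF face_succ_permutes])
      then show "face_succ M ` f = f"
        using face_succ_in_face fI finite_arcs unfolding a(2)
        by (intro endo_inj_surj) (auto intro: finite_subset)
    qed
    have "head (graph M) b = tail (graph M) (face_succ M b)" if "b \<in> f" for b
      using that fI tail_face_succ by (metis subsetD)
    then have "(\<Sum>b\<in>f. \<phi> (head (graph M) b)) = (\<Sum>b\<in>f. \<phi> (tail (graph M) (face_succ M b)))"
      by (simp cong: sum.cong)
    also have "\<dots> = (\<Sum>b\<in>f. \<phi> (tail (graph M) b))"
      using sum.reindex_bij_betw[OF bij, of "\<lambda>b. \<phi> (tail (graph M) b)"] .
    finally show ?thesis by (simp add: sum_subtractf)
  qed
  have co_anti: "\<phi> (head (graph M) (opp M a)) - \<phi> (tail (graph M) (opp M a)) =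
      - (\<phi> (head (graph M) a) - \<phi> (tail (graph M) a))"
    if "a \<in> ?I" for a and \<phi> :: "'a \<Rightarrow> 'h :: ab_group_add"
    using that by simp
  have opp_T: "opp M a \<in> ?I - T" if "a \<in> ?I - T" for a
  proof -
    have "opp M (opp M a) \<in> T" if "opp M a \<in> T"
      using grown_tree_props(4)[OF T] that unfolding image_subset_iff by blast
    then show ?thesis using that by auto
  qed
  have symm: "symmetric_arcs (?I - T) (opp M)" using opp_T by unfold_locales auto
  have "\<exists>J. symmetric_arcs.grown_tree (?I - T) (opp M) (tail (graph M)) ?V J"
  proof (rule symmetric_arcs.grown_tree_exists[OF symm])
    show "finite ?V" by simp
    show "?V \<noteq> {}" using map_connected by (simp add: connected_iff_closed)
    fix C assume C: "C \<subseteq> ?V" "C \<noteq> {}" "C \<noteq> ?V"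
    show "\<exists>e \<in> ?I - T. tail (graph M) e \<in> C \<and> tail (graph M) (opp M e) \<in> ?V - C"
    proof (rule ccontr)
      assume no: "\<not> ?thesis"
      let ?\<chi> = "\<lambda>u. if u \<in> C then 1 else 0 :: int"
      let ?g = "\<lambda>a. ?\<chi> (head (graph M) a) - ?\<chi> (tail (graph M) a)"
      have out: "head (graph M) a \<in> C" if "a \<in> ?I - T" "tail (graph M) a \<in> C" for a
        using no that by auto
      have outside: "?g a = 0" if "a \<in> ?I - T" for a
        using out[OF that] out[OF opp_T[OF that]] that by (auto split: if_splits)
      have zero: "?g a = 0" if "a \<in> ?I" for a
      proof (rule dual_zero[of ?g, OF _ _ _ that])
        show "?g (opp M a) = - ?g a" if "a \<in> ?I" for a by (rule co_anti[OF that])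
        show "sum ?g f = 0" if "f \<in> faces M" for f by (rule coboundary[OF that])
      qed (rule outside)
      then have "head (graph M) a \<in> C" if "a \<in> ?I" "tail (graph M) a \<in> C" for a
        using zero[OF that(1)] that(2) by (simp split: if_splits)
      then show False using no_proper_closed[OF C(1,2)] C(3) by simp
    qed
  qed
  then obtain J where J: "symmetric_arcs.grown_tree (?I - T) (opp M) (tail (graph M)) ?V J" ..
  interpret primal: symmetric_arcs "?I - T" "opp M" by (rule symm)
  have JI: "J \<subseteq> ?I - T" by (rule primal.grown_tree_props(2)[OF J])
  \<comment> \<open>The trees have 2V - 2 and 2F - 2 arcs, together 2E by Euler's formula. A further
    arc outside both would bring its reverse along and exceed the number of arcs.\<close>
  have "?I - T \<subseteq> J"
  proof (rule ccontr)
    assume "\<not> ?I - T \<subseteq> J"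
    then obtain a where a: "a \<in> ?I - T" "a \<notin> J" by blast
    have "opp M a \<in> ?I - T" using a by (intro primal.r_in)
    moreover have "opp M a \<notin> J"
      using primal.grown_tree_props(4)[OF J] a(2) by (metis arev_arev image_subset_iff)
    moreover have "opp M a \<noteq> a" using a arev_neq by blast
    ultimately have "card ((J \<union> T) \<union> {a, opp M a}) = card (J \<union> T) + 2"
      using a JI finite_arcs grown_tree_props(2)[OF T]
      by (subst card_Un_disjoint) (auto intro: finite_subset)
    moreover have "card ((J \<union> T) \<union> {a, opp M a}) \<le> card ?I"
      using a JI \<open>opp M a \<in> ?I - T\<close> grown_tree_props(2)[OF T] by (intro card_mono) auto
    moreover have "card (J \<union> T) = card J + card T"
      using JI grown_tree_props(2)[OF T] finite_arcs
      by (intro card_Un_disjoint) (auto intro: finite_subset)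
    ultimately have "card J + card T + 2 \<le> card ?I" by simp
    moreover have "card J + 2 = 2 * card ?V" "card T + 2 = 2 * card (faces M)"
      using primal.grown_tree_props(5)[OF J] grown_tree_props(5)[OF T] by blast+
    ultimately show False using euler unfolding euler_char_def by linarith
  qed
  with JI have "J = ?I - T" by blast
  moreover obtain \<phi> where "\<forall>a \<in> J. \<delta> a = \<phi> (tail (graph M) (opp M a)) - \<phi> (tail (graph M) a)"
    using primal.grown_tree_potential[OF J, of \<delta>] anti by blast
  ultimately have \<phi>: "\<delta> a = \<phi> (head (graph M) a) - \<phi> (tail (graph M) a)" if "a \<in> ?I - T" for a
    using that by simp
  \<comment> \<open>The error of the potential vanishes off the dual tree and still sums to zero
    over each face. It is therefore a flow on that tree, and must be zero.\<close>
  let ?g = "\<lambda>a. \<delta> a - (\<phi> (head (graph M) a) - \<phi> (tail (graph M) a))"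
  have "?g a = 0" if "a \<in> ?I" for a
  proof (rule dual_zero[of ?g, OF _ _ _ that])
    show "?g (opp M a) = - ?g a" if "a \<in> ?I" for a using that by (simp add: anti)
    show "?g a = 0" if "a \<in> ?I - T" for a using \<phi>[OF that] by simp
    show "sum ?g f = 0" if "f \<in> faces M" for f
      using faces[OF that] coboundary[OF that, of \<phi>] by (simp add: sum_subtractf)
  qed
  then show ?thesis by (intro exI[of _ \<phi>]) simp
qed


section \<open>Connectivity of the universal cover\<close>

lemma int_constant:
  fixes h :: "int \<Rightarrow> 'c"
  assumes "\<And>k. h k = h (k + 1)"
  shows "h i = h j"
proof -
  have "h k = h j" for k
  proof (induction k rule: int_induct[of _ j])
    case (step2 i)
    then show ?case using assms[of "i - 1"] by simp
  qed (use assms in auto)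
  then show ?thesis by simp
qed

text \<open>
  A point outside \<open>S\<close> has three lattice lines through it, and a point of \<open>S\<close> lies on at most one of
  them. So one of the lines avoids \<open>S\<close>.
\<close>

lemma triangular_lattice_constant:
  fixes m :: "int \<times> int \<Rightarrow> 'c"
  assumes fin: "finite S" and card: "card S \<le> 2"
    and H: "\<And>a b. (a, b) \<notin> S \<Longrightarrow> (a + 1, b) \<notin> S \<Longrightarrow> m (a, b) = m (a + 1, b)"
    and V: "\<And>a b. (a, b) \<notin> S \<Longrightarrow> (a, b + 1) \<notin> S \<Longrightarrow> m (a, b) = m (a, b + 1)"
    and D: "\<And>a b. (a, b) \<notin> S \<Longrightarrow> (a + 1, b - 1) \<notin> S \<Longrightarrow> m (a, b) = m (a + 1, b - 1)"
    and "p \<notin> S" "q \<notin> S"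
  shows "m p = m q"
proof -
  \<comment> \<open>A column and a row that avoid \<open>S\<close>. Their crossing
    \<open>(a0, b0)\<close> is the reference point to which every point outside \<open>S\<close> is
    connected.\<close>
  obtain a0 where "a0 \<notin> fst ` S" using ex_new_if_finite[of "fst ` S"] fin by auto
  then have a0: "(a0, k) \<notin> S" for k by force
  obtain b0 where "b0 \<notin> snd ` S" using ex_new_if_finite[of "snd ` S"] fin by auto
  then have b0: "(k, b0) \<notin> S" for k by force
  have row: "m (i, b) = m (j, b)" if "\<And>k. (k, b) \<notin> S" for b i j
    by (rule int_constant[of "\<lambda>k. m (k, b)"]) (intro H that)
  have col: "m (a, i) = m (a, j)" if "\<And>k. (a, k) \<notin> S" for a i j
    by (rule int_constant[of "\<lambda>k. m (a, k)"]) (intro V that)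
  have diag: "m (i, c - i) = m (j, c - j)" if "\<And>k. (k, c - k) \<notin> S" for c i j
  proof (rule int_constant[of "\<lambda>k. m (k, c - k)"])
    show "m (k, c - k) = m (k + 1, c - (k + 1))" for k
      using D[of k "c - k"] that[of k] that[of "k + 1"] by (simp add: algebra_simps)
  qed
  have "m (a, b) = m (a0, b0)" if "(a, b) \<notin> S" for a b
  proof -
    consider "\<And>k. (k, b) \<notin> S" | "\<And>k. (a, k) \<notin> S" | "\<And>k. (k, (a + b) - k) \<notin> S"
    proof (rule ccontr)
      assume "\<not> thesis"
      then have "\<exists>k. (k, b) \<in> S" "\<exists>k. (a, k) \<in> S" "\<exists>k. (k, a + b - k) \<in> S"
        using that by blast+
      then obtain k1 k2 k3 where k: "(k1, b) \<in> S" "(a, k2) \<in> S" "(k3, a + b - k3) \<in> S"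
        by blast
      have "k1 \<noteq> a" "k2 \<noteq> b" "k3 \<noteq> a" using k \<open>(a, b) \<notin> S\<close> by auto
      then have "card {(k1, b), (a, k2), (k3, a + b - k3)} = 3" by auto
      then show False using card_mono[OF fin, of "{(k1, b), (a, k2), (k3, a + b - k3)}"] k card
        by simp
    qed
    then show ?thesis
    proof cases
      case 1
      then show ?thesis using row[of b a a0] col[of a0 b b0] a0 by simp
    next
      case 2
      then show ?thesis using col[of a b b0] row[of b0 a a0] b0 by simp
    next
      case 3
      then show ?thesis using diag[of "a + b" a a0] col[of a0 "a + b - a0" b0] a0 by simp
    qed
  qed
  then show ?thesis using assms(6,7) by (metis prod.exhaust)
qed

text \<open>
  The outer face of the planar map lies in a triangle of loops with corners at the copies
  \<open>corner_shift i\<close> of the new vertex.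
\<close>

definition corner_shift :: "3 \<Rightarrow> int \<times> int" where
  "corner_shift i = (if i = 0 then (0, 0) else if i = 1 then (1, 0) else (0, 1))"

text \<open>Old arcs stay within their copy of \<open>G\<close>, so copy \<open>z\<close> has the
  new vertex at \<open>z + corner_shift i\<close> as the other end of its \<open>i\<close>-th spoke.
  \<open>Loop i True\<close> is the side of the triangle from corner \<open>i + 1\<close> to corner
  \<open>i\<close>. The three loops thus receive (-1,0), (1,-1) and (0,1), which are nonzero and
  pairwise distinct even up to sign.\<close>

primrec plus_shift :: "'b ext_arc \<Rightarrow> int \<times> int" where
  "plus_shift (Old b) = 0"
| "plus_shift (Spoke i out) = (if out then - corner_shift i else corner_shift i)"
| "plus_shift (Loop i d) =
     (if d then corner_shift i - corner_shift (i + 1) else corner_shift (i + 1) - corner_shift i)"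

lemma corner_shift_simps [simp]:
  "corner_shift 0 = (0, 0)" "corner_shift 1 = (1, 0)" "corner_shift 2 = (0, 1)"
  by (simp_all add: corner_shift_def)

lemma three_eq_zero [simp]: "(3 :: 3) = 0"
  by simp

lemma three_add_one [simp]: "(1 :: 3) + 1 = 2" "(2 :: 3) + 1 = 0"
  by simp_all

lemma three_diff_one [simp]: "(0 :: 3) - 1 = 2" "(1 :: 3) - 1 = 0" "(2 :: 3) - 1 = 1"
  by (simp_all add: diff_eq_eq)

lemma inj_corner_shift: "inj corner_shift"
proof (rule injI)
  fix i j show "corner_shift i = corner_shift j \<Longrightarrow> i = j"
    using exhaust_three[of i] exhaust_three[of j] by auto
qed

lemma apex_loops_graph_simps [simp]:
  "verts (apex_loops_graph G x) = insert None (Some ` verts G)"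
  "tail (apex_loops_graph G x) = ext_tail G x"
  "head (apex_loops_graph G x) = ext_head G x"
  "arcs (apex_loops_graph G x) =
    Old ` arcs G \<union> {Spoke i out | i out. True} \<union> {Loop i d | i d. True}"
  by (simp_all add: apex_loops_graph_def)

lemma universal_cover_simps [simp]:
  "verts (universal_cover G \<delta>) = verts G \<times> UNIV"
  "arcs (universal_cover G \<delta>) = arcs G \<times> UNIV"
  "tail (universal_cover G \<delta>) (a, z) = (tail G a, z)"
  "head (universal_cover G \<delta>) (a, z) = (head G a, z + \<delta> a)"
  by (simp_all add: universal_cover_def)

lemma infinite_verts_universal_cover:
  "verts G \<noteq> {} \<Longrightarrow> infinite (verts (universal_cover G \<delta>))"
  by (simp add: finite_cartesian_product_iff infinite_UNIV_int finite_prod)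

text \<open>Charges a deleted set against a single copy \<open>z\<close> of the graph: deleted
  vertices in that copy and deleted copies of the new vertex at the places \<open>t i\<close> are
  disjoint parts of \<open>S\<close>.\<close>

lemma card_Some_None_le:
  fixes S :: "('a option \<times> 'b) set"
  assumes "finite S" "inj t"
  shows "card {u. (Some u, z) \<in> S} + card {i. (None, t i) \<in> S} \<le> card S"
proof -
  let ?A = "(\<lambda>u. (Some u, z)) ` {u. (Some u, z) \<in> S}" 
    and ?B = "(\<lambda>i. (None :: 'a option, t i)) ` {i. (None, t i) \<in> S}"
  have "?A \<union> ?B \<subseteq> S" by auto
  then have "card (?A \<union> ?B) \<le> card S" using assms(1) by (rule card_mono[rotated])
  moreover have "finite ?A" "finite ?B" using \<open>?A \<union> ?B \<subseteq> S\<close> assms(1) by (auto intro: finite_subset)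
  then have "card (?A \<union> ?B) = card ?A + card ?B" by (intro card_Un_disjoint) auto
  moreover have "card ?A = card {u. (Some u, z) \<in> S}" by (intro card_image inj_onI) auto
  moreover have "card ?B = card {i. (None, t i) \<in> S}"
    using assms(2) by (intro card_image inj_onI) (auto dest: injD)
  ultimately show ?thesis by simp
qed

lemma k_connected_universal_cover:
  fixes G :: "('a, 'b) pre_digraph" and x :: "3 \<Rightarrow> 'a"
  assumes fin: "finite (verts G)" and X: "range x \<subseteq> verts G" "inj x"
    and sep: "apex_3_connected G (range x)"
  shows "k_connected 3 (universal_cover (apex_loops_graph G x) plus_shift)" (is "k_connected 3 ?U")
proof -
  have "connected (?U \<restriction> (verts ?U - S))"
    if S: "S \<subseteq> verts ?U" "finite S" "card S < 3" for S
    unfolding connected_induce_iff_closed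
  proof (intro conjI allI impI)
    let ?W = "verts ?U - S"
    have "infinite ?W" using infinite_verts_universal_cover[of "apex_loops_graph G x"] S(2) by simp
    then show "?W \<noteq> {}" by (metis finite.emptyI)
    fix C assume "C \<subseteq> ?W" and C: "C \<noteq> {} \<and> closed_within ?U ?W C"
    define N where "N = {z. (None, z) \<in> S}"
    have N: "finite N" "card N \<le> 2"
    proof -
      have inj: "inj_on (\<lambda>z. (None :: 'a option, z)) N" by (auto intro: inj_onI)
      have sub: "(\<lambda>z. (None :: 'a option, z)) ` N \<subseteq> S" by (auto simp: N_def)
      show "finite N" using inj sub S(2) by (metis finite_imageD finite_subset)
      show "card N \<le> 2" using card_mono[OF S(2) sub] card_image[OF inj] S(3) by simp
    qed
    have loop: "(None, z) \<in> C \<longleftrightarrow> (None, z + plus_shift (Loop i True :: 'b ext_arc)) \<in> C"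
      if "z \<notin> N" "z + plus_shift (Loop i True :: 'b ext_arc) \<notin> N" for z i
      using closed_withinD[OF conjunct2[OF C], of "(Loop i True, z)"] that by (auto simp: N_def)
    have hub: "(None, p) \<in> C \<longleftrightarrow> (None, q) \<in> C" if "p \<notin> N" "q \<notin> N" for p q
    proof (rule triangular_lattice_constant[OF N _ _ _ that])
      fix a b
      \<comment> \<open>\<open>Loop 0 True\<close> has displacement (-1,0), so this step is
        traversed from its right end. The loops 2 and 1 give (0,1) and (1,-1) directly.\<close>
      show "(None, (a, b)) \<in> C \<longleftrightarrow> (None, (a + 1, b)) \<in> C" if "(a, b) \<notin> N" "(a + 1, b) \<notin> N"
        using loop[of "(a + 1, b)" 0] that by simp
      show "(None, (a, b)) \<in> C \<longleftrightarrow> (None, (a, b + 1)) \<in> C" if "(a, b) \<notin> N" "(a, b + 1) \<notin> N"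
        using loop[of "(a, b)" 2] that by simp
      show "(None, (a, b)) \<in> C \<longleftrightarrow> (None, (a + 1, b - 1)) \<in> C"
        if "(a, b) \<notin> N" "(a + 1, b - 1) \<notin> N"
        using loop[of "(a, b)" 1] that by simp
    qed
    have attached: "\<exists>p. p \<notin> N \<and> ((Some u, z) \<in> C \<longleftrightarrow> (None, p) \<in> C)"
      if u: "u \<in> verts G" "(Some u, z) \<notin> S" for u z
    proof -
      let ?S = "{w. (Some w, z) \<in> S}"
      \<comment> \<open>The surviving vertices of copy \<open>z\<close> on the same side of
        \<open>C\<close> as \<open>u\<close>, whichever side that is, so that one argument covers
        \<open>C\<close> and its complement.\<close>
      let ?D = "{w \<in> verts G - ?S. (Some w, z) \<in> C \<longleftrightarrow> (Some u, z) \<in> C}"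
      let ?B = "{i. (None, z + corner_shift i) \<in> S}"
      have "closed_within G (verts G - ?S) ?D"
        unfolding closed_within_def
      proof (intro ballI impI)
        fix a assume a: "a \<in> arcs G" "tail G a \<in> verts G - ?S \<and> head G a \<in> verts G - ?S"
        then show "tail G a \<in> ?D \<longleftrightarrow> head G a \<in> ?D"
          using closed_withinD[OF conjunct2[OF C], of "(Old a, z)"] by auto
      qed
      moreover have "?S \<subseteq> verts G" using S(1) by auto
      moreover have "u \<in> ?D" using u by simp
      ultimately have "3 \<le> card ?S + card (?D \<inter> range x)"
        using sep[unfolded apex_3_connected_def, rule_format, of ?S ?D] by blast
      moreover have "card ?S + card ?B \<le> card S"
        by (rule card_Some_None_le[OF S(2)]) (auto intro!: injI dest: injD[OF inj_corner_shift])
      \<comment> \<open>Since \<open>S\<close> has fewer than three elements, the criterion gives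
        \<open>?D\<close> more vertices of \<open>range x\<close> than there are deleted lattice
        points around the copy. One of these vertices still has its neighbour in the
        lattice.\<close>
      ultimately have "card ?B < card (?D \<inter> range x)" using S(3) by linarith
      moreover have "card (?D \<inter> range x) \<le> card ?B" if "?D \<inter> range x \<subseteq> x ` ?B"
        using that by (meson card_image_le card_mono finite finite_imageI le_trans)
      ultimately obtain i where i: "x i \<in> ?D" "(None, z + corner_shift i) \<notin> S" by fastforce
      then have "(Some (x i), z) \<in> C \<longleftrightarrow> (None, z + corner_shift i) \<in> C"
        using closed_withinD[OF conjunct2[OF C], of "(Spoke i False, z)"] X by auto
      then show ?thesis using i by (intro exI[of _ "z + corner_shift i"]) (simp add: N_def)
    qed
    have rep: "\<exists>p. p \<notin> N \<and> (w \<in> C \<longleftrightarrow> (None, p) \<in> C)" if "w \<in> ?W" for w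
      using that attached by (cases w, cases "fst w") (auto simp: N_def)
    have "w \<in> C \<longleftrightarrow> w' \<in> C" if "w \<in> ?W" "w' \<in> ?W" for w w'
      using rep[OF that(1)] rep[OF that(2)] hub by blast
    then show "C = ?W" using C \<open>C \<subseteq> ?W\<close> by blast
  qed
  then show ?thesis unfolding k_connected_def
    using infinite_verts_universal_cover[of "apex_loops_graph G x"] by simp
qed

text \<open>By the potential, the vertices \<open>(Some u, \<phi> u)\<close> span a copy of
  \<open>G\<close> that old arcs neither enter nor leave. Only spokes lead out of it, one for each
  \<open>x i\<close>, so a violation of the criterion becomes a cut of the cover with at most two
  vertices.\<close>

lemma apex_3_connected_of_cover:
  fixes G :: "('a, 'b) pre_digraph" and x :: "3 \<Rightarrow> 'a"
  assumes fin: "finite (verts G)" and "inj x"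
    and conn: "k_connected 3 (universal_cover (apex_loops_graph G x) \<delta>)" (is "k_connected 3 ?U")
    and pot: "\<And>a. a \<in> arcs G \<Longrightarrow> \<delta> (Old a) = \<phi> (head G a) - \<phi> (tail G a)"
    and spoke: "\<And>i. \<delta> (Spoke i False) = - \<delta> (Spoke i True)"
  shows "apex_3_connected G (range x)"
  unfolding apex_3_connected_def
proof (intro allI impI, elim conjE, rule ccontr)
  fix S D assume S: "S \<subseteq> verts G" and D: "D \<subseteq> verts G - S" "D \<noteq> {}"
    and closed: "closed_within G (verts G - S) D"
    and less: "\<not> 3 \<le> card S + card (D \<inter> range x)"
  let ?lift = "\<lambda>u. (Some u, \<phi> u)" and ?apex = "\<lambda>i. (None :: 'a option, \<phi> (x i) - \<delta> (Spoke i True))"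
  \<comment> \<open>The spoke that ends at level \<open>\<phi> (x i)\<close> starts at the copy of
    the new vertex lower by its displacement, hence the subtraction in \<open>?apex\<close>.\<close>
  let ?S = "?lift ` S \<union> ?apex ` {i. x i \<in> D}"
  have finS: "finite S" "finite D" using S D(1) fin finite_subset by blast+
  have "card ?S \<le> card (?lift ` S) + card (?apex ` {i. x i \<in> D})" by (rule card_Un_le)
  also have "\<dots> \<le> card S + card {i. x i \<in> D}"
    using finS by (intro add_mono card_image_le) auto
  also have "card {i. x i \<in> D} = card (x ` {i. x i \<in> D})"
    using \<open>inj x\<close> by (intro card_image[symmetric]) (auto intro: inj_on_subset)
  also have "x ` {i. x i \<in> D} = D \<inter> range x" by auto
  finally have "card ?S < 3" using less by simp
  moreover have "?S \<subseteq> verts ?U" using S by auto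
  moreover have "finite ?S" using finS by simp
  ultimately have "connected (?U \<restriction> (verts ?U - ?S))"
    using conn unfolding k_connected_def by blast
  moreover have "?lift ` D \<subseteq> verts ?U - ?S" "?lift ` D \<noteq> {}" using D by auto
  moreover have "closed_within ?U (verts ?U - ?S) (?lift ` D)"
    unfolding closed_within_def
  proof (intro ballI impI, elim conjE)
    fix e assume e: "e \<in> arcs ?U" and te: "tail ?U e \<in> verts ?U - ?S"
      and he: "head ?U e \<in> verts ?U - ?S"
    obtain a z where [simp]: "e = (a, z)" by (cases e)
    consider b where "b \<in> arcs G" "a = Old b" | i where "a = Spoke i True"
      | i where "a = Spoke i False" | i d where "a = Loop i d"
      using e by auto
    then show "tail ?U e \<in> ?lift ` D \<longleftrightarrow> head ?U e \<in> ?lift ` D"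
    proof cases
      case 1
      have "z = \<phi> (tail G b) \<longleftrightarrow> z + \<delta> a = \<phi> (head G b)"
        unfolding 1(2) pot[OF 1(1)] by (auto simp: algebra_simps)
      moreover have "tail G b \<in> D \<longleftrightarrow> head G b \<in> D" if "z = \<phi> (tail G b)" "z + \<delta> a = \<phi> (head G b)"
        using te he that 1 by (intro closed_withinD[OF closed]) auto
      ultimately show ?thesis using 1(2) by auto
    next
      case (2 i)
      then show ?thesis using te by (auto simp: algebra_simps image_iff)
    next
      case (3 i)
      then show ?thesis using he by (auto simp: algebra_simps image_iff spoke)
    next
      case 4
      then show ?thesis by auto
    qed
  qed
  ultimately have "?lift ` D = verts ?U - ?S" unfolding connected_induce_iff_closed by blast
  \<comment> \<open>The finite lift of \<open>D\<close> cannot be all that remains of the infinite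
    cover.\<close>
  moreover have "infinite (verts ?U - ?S)"
    using infinite_verts_universal_cover[of "apex_loops_graph G x"] \<open>finite ?S\<close> by simp
  ultimately show False using finS by (metis finite_imageI)
qed


section \<open>Displacement and homotopy\<close>

lemma bij_betw_funpow_orbit:
  assumes "s \<in> orbit p s"
  shows "bij_betw (\<lambda>i. (p ^^ i) s) {0..<card (orbit p s)} (orbit p s)"
    and "(p ^^ card (orbit p s)) s = s"
proof -
  let ?n = "funpow_dist1 p s s"
  have inj: "inj_on (\<lambda>i. (p ^^ i) s) {0..<?n}" using assms by (rule inj_on_funpow_dist1)
  have orb: "orbit p s = (\<lambda>i. (p ^^ i) s) ` {0..<?n}" using assms by (rule orbit_conv_funpow_dist1)
  have "card (orbit p s) = ?n" unfolding orb card_image[OF inj] by simp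
  then show "bij_betw (\<lambda>i. (p ^^ i) s) {0..<card (orbit p s)} (orbit p s)"
    and "(p ^^ card (orbit p s)) s = s"
    using inj orb funpow_dist1_prop[OF assms] by (simp_all add: bij_betw_def)
qed

lemma (in combinatorial_map) sum_list_face_walk:
  fixes \<delta> :: "'b \<Rightarrow> 'g :: comm_monoid_add"
  shows "sum_list (map \<delta> (face_walk M a)) = sum \<delta> (face_of M a)"
proof -
  have bij: "bij_betw (\<lambda>i. (face_succ M ^^ i) a) {0..<card (face_of M a)} (face_of M a)"
    using bij_betw_funpow_orbit(1)[of a "face_succ M"] face_of_self[of a] unfolding face_of_def .
  have "sum_list (map \<delta> (face_walk M a)) =
      (\<Sum>i \<in> {0..<card (face_of M a)}. \<delta> ((face_succ M ^^ i) a))"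
    unfolding face_walk_def map_map comp_def by (subst sum_list_distinct_conv_sum_set) simp_all
  also have "\<dots> = sum \<delta> (face_of M a)" by (rule sum.reindex_bij_betw[OF bij])
  finally show ?thesis .
qed

text \<open>Each generating step removes a piece of sum zero: an arc followed by its reverse, or the
  boundary walk of a face. This is the invariant that tells the loops at the new vertex
  apart.\<close>

lemma (in combinatorial_map) homotopic_walks_sum_eq:
  fixes \<delta> :: "'b \<Rightarrow> 'g :: ab_group_add"
  assumes anti: "\<And>a. a \<in> arcs (graph M) \<Longrightarrow> \<delta> (opp M a) = - \<delta> a"
    and faces: "\<And>g. g \<in> faces M \<Longrightarrow> sum \<delta> g = 0"
    and "homotopic_walks M p q"
  shows "sum_list (map \<delta> p) = sum_list (map \<delta> q)"
proof -
  have step: "sum_list (map \<delta> p) = sum_list (map \<delta> q)" if "homotopy_step M p q" for p q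
    using that
  proof cases
    case (backtrack u p' a q' w)
    then have "a \<in> arcs (graph M)" by (auto simp: awalk_def)
    then show ?thesis using backtrack anti by simp
  next
    case (face u p' a q' w)
    then have "face_of M a \<in> faces M" by (auto simp: faces_def)
    then show ?thesis using face faces by (simp add: sum_list_face_walk)
  qed
  show ?thesis
    using assms(3) unfolding homotopic_walks_def
    by (induction rule: equivclp_induct) (auto dest: step)
qed

text \<open>A closed walk with displacement \<open>z\<close> is the projection of a walk in the cover.\<close>

lemma (in combinatorial_map) closed_walk_of_shift:
  assumes anti: "\<And>a. a \<in> arcs (graph M) \<Longrightarrow> \<delta> (opp M a) = - \<delta> a"
    and conn: "connected (universal_cover (graph M) \<delta>)" and u: "u \<in> verts (graph M)"
  shows "\<exists>p. awalk u p u \<and> sum_list (map \<delta> p) = z"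
proof -
  let ?U = "universal_cover (graph M) \<delta>"
  let ?C = "{(w, y). \<exists>p. awalk u p w \<and> sum_list (map \<delta> p) = y}"
  have app: "\<exists>p. awalk u p (head (graph M) a) \<and> sum_list (map \<delta> p) = y + \<delta> a"
    if "awalk u p (tail (graph M) a)" "sum_list (map \<delta> p) = y" "a \<in> arcs (graph M)" for p y a
    using that by (intro exI[of _ "p @ [a]"]) (auto simp: awalk_append_iff awalk_simps)
  have "?C = verts ?U"
  proof (rule conn[unfolded connected_iff_closed, THEN conjunct2, rule_format, OF _ conjI])
    show "?C \<subseteq> verts ?U" by (auto dest: awalk_last_in_verts)
    have "(u, 0) \<in> ?C" using u by (auto intro!: exI[of _ "[]"] simp: awalk_Nil_iff)
    then show "?C \<noteq> {}" by blast
    show "closed_within ?U (verts ?U) ?C"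
      unfolding closed_within_def
    proof (intro ballI impI)
      fix e assume "e \<in> arcs ?U"
      then obtain a y where e: "e = (a, y)" and a: "a \<in> arcs (graph M)" by auto
      show "tail ?U e \<in> ?C \<longleftrightarrow> head ?U e \<in> ?C"
      proof
        assume "tail ?U e \<in> ?C"
        then obtain p where "awalk u p (tail (graph M) a)" "sum_list (map \<delta> p) = y"
          unfolding e by auto
        from app[OF this a] show "head ?U e \<in> ?C" unfolding e by simp
      next
        assume "head ?U e \<in> ?C"
        then obtain p where "awalk u p (tail (graph M) (opp M a))" "sum_list (map \<delta> p) = y + \<delta> a"
          using a unfolding e by auto
        from app[OF this] show "tail ?U e \<in> ?C" using a unfolding e by (simp add: anti)
      qed
    qed
  qed
  then have "(u, z) \<in> ?C" using u by simp
  then show ?thesis by simp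
qed


section \<open>The planar part of the toroidal map\<close>

text \<open>
  The inner faces remain faces of the toroidal map, so they have displacement zero. Then so has the
  outer face, because the displacements of all arcs cancel.
\<close>

lemma (in combinatorial_map) face_of_Old:
  fixes T :: "('a option, 'b ext_arc) cmap"
  assumes "opp T = ext_opp (opp M)"
    and rot: "\<And>b. b \<in> arcs (graph M) \<Longrightarrow> rot M b \<notin> K \<Longrightarrow> rot T (Old b) = Old (rot M b)"
    and a: "a \<in> arcs (graph M)" "face_of M a \<inter> K = {}"
  shows "face_of T (Old a) = Old ` face_of M a"
proof -
  have "face_succ T (Old b) = Old (face_succ M b)" if "b \<in> face_of M a" for b
  proof -
    have "b \<in> arcs (graph M)" using that face_of_subset[OF a(1)] by blast
    moreover have "face_succ M b \<notin> K" using face_succ_in_face[OF that] a(2) by blast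
    ultimately show ?thesis using assms(1) rot[of "opp M b"] by (simp add: face_succ_def)
  qed
  then have "cyclic_on (face_succ T) (Old ` face_of M a)"
    by (intro cyclic_on_image[OF face_of_cyclic]) auto
  then show ?thesis
    using face_of_self[of a] unfolding cyclic_on_alldef by (auto simp: face_of_def)
qed

lemma flat_representationD:
  assumes "flat_representation M \<delta>"
  shows "a \<in> arcs (graph M) \<Longrightarrow> \<delta> (opp M a) = - \<delta> a"
    and "g \<in> faces M \<Longrightarrow> sum \<delta> g = 0"
  using assms by (simp_all add: flat_representation_def)

lemma (in combinatorial_map) faces_disjoint:
  assumes "arcs (graph M) \<noteq> {}" "g \<in> faces M" "h \<in> faces M" "g \<noteq> h"
  shows "g \<inter> h = {}"
  using arcs_of_face[OF assms(1,2)] arcs_of_face[OF assms(1,3)] assms(4) by blast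

lemma planar_potential_of_plus_map:
  assumes "planar_map M f" and plus: "is_plus_map M f x T" and flat: "flat_representation T \<delta>"
  shows "\<exists>\<phi>. \<forall>a \<in> arcs (graph M).
    \<delta> (Old a) = \<phi> (head (graph M) a) - \<phi> (tail (graph M) a)"
proof -
  interpret combinatorial_map M using assms(1) by (simp add: planar_map_def)
  let ?I = "arcs (graph M)"
  have f: "f \<in> faces M" and euler: "euler_char M = 2"
    using assms(1) by (simp_all add: planar_map_def)
  have T: "opp T = ext_opp (opp M)" "graph T = apex_loops_graph (graph M) x"
    using plus by (simp_all add: is_plus_map_def)
  have "\<exists>c. ccw_corners M f x c \<and>
      (\<forall>a \<in> ?I. rot M a \<notin> range c \<longrightarrow> rot T (Old a) = Old (rot M a))"
    using plus unfolding is_plus_map_def by (elim conjE exE) (intro exI conjI)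
  then obtain c :: "3 \<Rightarrow> 'b" where c: "range c \<subseteq> f"
    and rot: "\<And>a. a \<in> ?I \<Longrightarrow> rot M a \<notin> range c \<Longrightarrow> rot T (Old a) = Old (rot M a)"
    unfolding ccw_corners_def by metis
  have ne: "?I \<noteq> {}"
    using f c unfolding faces_def by (auto split: if_splits)
  have anti: "\<delta> (Old (opp M a)) = - \<delta> (Old a)" if "a \<in> ?I" for a
    using flat_representationD(1)[OF flat, of "Old a"] that T by simp
  have inner: "(\<Sum>a\<in>g. \<delta> (Old a)) = 0" if g: "g \<in> faces M" "g \<noteq> f" for g
  proof -
    obtain a where a: "a \<in> ?I" "g = face_of M a" using g(1) by (auto simp: faces_eq[OF ne])
    have "face_of M a \<inter> range c = {}"
      using faces_disjoint[OF ne g(1) f g(2)] c a(2) by blast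
    then have "face_of T (Old a) = Old ` g"
      using face_of_Old[OF T(1) rot a(1)] a(2) by simp
    moreover have "face_of T (Old a) \<in> faces T" using a T by (auto simp: faces_def)
    ultimately have "sum \<delta> (Old ` g) = 0" using flat_representationD(2)[OF flat] by simp
    then show ?thesis by (subst (asm) sum.reindex) (auto intro: inj_onI)
  qed
  have "(\<Sum>a\<in>?I. \<delta> (Old a)) = (\<Sum>a\<in>?I. \<delta> (Old (opp M a)))"
    by (rule sum.permute[OF arev_permutes_arcs, unfolded comp_def])
  also have "\<dots> = - (\<Sum>a\<in>?I. \<delta> (Old a))" by (simp add: anti sum_negf)
  \<comment> \<open>A sum equal to its own negative vanishes because the integers, in each
    coordinate, have no 2-torsion.\<close>
  finally have total: "(\<Sum>a\<in>?I. \<delta> (Old a)) = 0" by (simp add: prod_eq_iff)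
  have finF: "finite (faces M)" by (simp add: faces_eq[OF ne])
  have "0 = (\<Sum>g\<in>faces M. \<Sum>a | a \<in> ?I \<and> face_of M a = g. \<delta> (Old a))"
    using total finF by (subst sum.group) (auto simp: faces_eq[OF ne])
  also have "\<dots> = (\<Sum>g\<in>faces M. \<Sum>a\<in>g. \<delta> (Old a))"
    by (intro sum.cong refl) (simp add: arcs_of_face[OF ne])
  also have "\<dots> = (\<Sum>a\<in>f. \<delta> (Old a))"
    using finF f inner by (simp add: sum.remove)
  finally have "(\<Sum>a\<in>g. \<delta> (Old a)) = 0" if "g \<in> faces M" for g
    using inner that by metis
  then show ?thesis using planar_potential[OF euler ne, of "\<lambda>a. \<delta> (Old a)"] anti by blast
qed


section \<open>Construction of the toroidal map\<close>

text \<open>An orbit is itself a nonempty closed subset, so minimality makes it everything.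
  Cyclicity of a rotation can thus be checked without listing its orbit.\<close>

lemma cyclic_onI_closed:
  assumes "S \<noteq> {}" "\<And>e. e \<in> S \<Longrightarrow> p e \<in> S"
    and min: "\<And>B. B \<subseteq> S \<Longrightarrow> B \<noteq> {} \<Longrightarrow> (\<And>e. e \<in> B \<Longrightarrow> p e \<in> B) \<Longrightarrow> S \<subseteq> B"
  shows "cyclic_on p S"
proof -
  obtain s where s: "s \<in> S" using assms(1) by blast
  have sub: "orbit p s \<subseteq> S"
  proof
    fix e assume "e \<in> orbit p s"
    then show "e \<in> S" by induction (simp_all add: assms(2) s)
  qed
  moreover have "S \<subseteq> orbit p s"
    by (rule min[OF sub]) (auto intro: orbit.intros)
  ultimately have "S = orbit p s" by (rule subset_antisym[rotated])
  with s show ?thesis by (rule cyclic_on_singleI)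
qed

lemma cyclic_on_closed_subset:
  assumes "cyclic_on p S" "B \<subseteq> S" "B \<noteq> {}" "\<And>e. e \<in> B \<Longrightarrow> p e \<in> B"
  shows "B = S"
proof -
  obtain s where s: "s \<in> B" using assms(3) by blast
  then have "S = orbit p s" using assms(1,2) unfolding cyclic_on_alldef by blast
  moreover have "orbit p s \<subseteq> B"
  proof
    fix e assume "e \<in> orbit p s"
    then show "e \<in> B" by induction (simp_all add: assms(4) s)
  qed
  ultimately show ?thesis using assms(2) by blast
qed

text \<open>At the new vertex the cyclic order reads \<open>Spoke i True\<close>,
  \<open>Loop (i - 1) True\<close>, \<open>Loop (i + 1) False\<close>,
  \<open>Spoke (i + 1) True\<close>: two loop ends separate consecutive spokes. At an old vertex,
  \<open>Spoke i False\<close> is inserted immediately before \<open>Old (c i)\<close>.\<close>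

primrec plus_rot :: "('a, 'b) cmap \<Rightarrow> (3 \<Rightarrow> 'b) \<Rightarrow> 'b ext_arc \<Rightarrow> 'b ext_arc" where
  "plus_rot M c (Old a) =
     (if rot M a \<in> range c then Spoke (inv c (rot M a)) False else Old (rot M a))"
| "plus_rot M c (Spoke i out) = (if out then Loop (i - 1) True else Old (c i))"
| "plus_rot M c (Loop i d) = (if d then Loop (i - 1) False else Spoke i True)"

definition plus_map ::
  "('a, 'b) cmap \<Rightarrow> (3 \<Rightarrow> 'a) \<Rightarrow> (3 \<Rightarrow> 'b) \<Rightarrow> ('a option, 'b ext_arc) cmap" where
  "plus_map M x c =
     \<lparr> graph = apex_loops_graph (graph M) x, opp = ext_opp (opp M), rot = plus_rot M c \<rparr>"

lemma plus_map_simps [simp]: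
  "graph (plus_map M x c) = apex_loops_graph (graph M) x"
  "opp (plus_map M x c) = ext_opp (opp M)"
  "rot (plus_map M x c) = plus_rot M c"
  by (simp_all add: plus_map_def)

lemma ext_arcs_UNIV:
  "{Spoke i out | i out. True} = (\<lambda>(i, out). Spoke i out) ` UNIV"
  "{Loop i d | i d. True} = (\<lambda>(i, d). Loop i d) ` UNIV"
  by auto

lemma finite_ext_arcs [simp]:
  "finite {e :: 'b ext_arc. \<exists>i out. e = Spoke i out}"
  "finite {e :: 'b ext_arc. \<exists>i d. e = Loop i d}"
proof -
  have "finite {Spoke i out :: 'b ext_arc | i out. True}" "finite {Loop i d :: 'b ext_arc | i d. True}"
    unfolding ext_arcs_UNIV by (intro finite_imageI finite)+
  then show "finite {e :: 'b ext_arc. \<exists>i out. e = Spoke i out}"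
    and "finite {e :: 'b ext_arc. \<exists>i d. e = Loop i d}" by simp_all
qed

lemma card_ext_arcs:
  "card {Spoke i out :: 'b ext_arc | i out. True} = 6"
  "card {Loop i d :: 'b ext_arc | i d. True} = 6"
  unfolding ext_arcs_UNIV by (subst card_image; auto intro: inj_onI simp: card_prod)+

lemma ext_arc_in_apex_loops:
  "Old a \<in> arcs (apex_loops_graph G x) \<longleftrightarrow> a \<in> arcs G"
  "Spoke i out \<in> arcs (apex_loops_graph G x)"
  "Loop i d \<in> arcs (apex_loops_graph G x)"
  by auto

text \<open>
  The corners cut the boundary walk of the outer face into the segments of positions
  \<open>{start i..<stop i}\<close>; closed up by two spokes and a loop, each segment bounds a face.
\<close>

locale plus_construction = combinatorial_map M for M :: "('a, 'b) cmap" +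
  fixes f :: "'b set" and x :: "3 \<Rightarrow> 'a" and c :: "3 \<Rightarrow> 'b" and start stop :: "3 \<Rightarrow> nat"
  assumes f_face: "f \<in> faces M"
    and c_in: "c i \<in> f"
    and tail_c: "tail (graph M) (c i) = x i"
    and inj_x: "inj x"
    and start_0: "start 0 = 0"
    and start_stop: "start i < stop i"
    and stop_0: "stop 0 = start 1" and stop_1: "stop 1 = start 2" and stop_2: "stop 2 = card f"
    and c_start: "c i = (face_succ M ^^ start i) (c 0)"
begin

abbreviation T :: "('a option, 'b ext_arc) cmap" where "T \<equiv> plus_map M x c"

lemma arcs_ne: "arcs (graph M) \<noteq> {}"
  using f_face c_in unfolding faces_def by (auto split: if_splits)

lemma f_arcs: "f \<subseteq> arcs (graph M)"
  using f_face face_of_subset by (auto simp: faces_eq[OF arcs_ne])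

lemma c_arcs: "c i \<in> arcs (graph M)"
  using c_in f_arcs by blast

lemma f_eq: "a \<in> f \<Longrightarrow> face_of M a = f"
  using f_face face_of_eq by (auto simp: faces_eq[OF arcs_ne])

lemma x_verts: "x i \<in> verts (graph M)"
  using tail_c[of i, symmetric] c_arcs[of i] by simp

lemma inj_c: "inj c"
  using inj_x tail_c by (metis injD injI)

lemma rot_corner: "rot M a = c i \<Longrightarrow> plus_rot M c (Old a) = Spoke i False"
  using inj_c by (simp add: inv_f_f)

lemma rot_no_corner: "rot M a \<notin> range c \<Longrightarrow> plus_rot M c (Old a) = Old (rot M a)"
  by simp

lemma Old_rot_cases:
  obtains i where "rot M a = c i" "plus_rot M c (Old a) = Spoke i False"
  | "rot M a \<notin> range c" "plus_rot M c (Old a) = Old (rot M a)"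
  using rot_corner rot_no_corner by blast

lemma rot_arcs: "a \<in> arcs (graph M) \<longleftrightarrow> rot M a \<in> arcs (graph M)"
  using rot_permutes by (simp add: permutes_in_image)

lemma plus_rot_permutes: "plus_rot M c permutes arcs (graph T)"
proof (rule bij_imp_permutes)
  let ?A = "arcs (graph T)" and ?p = "plus_rot M c"
  have fin: "finite ?A" by simp
  have maps: "?p ` ?A \<subseteq> ?A"
  proof
    fix e assume "e \<in> ?p ` ?A"
    then obtain b where b: "b \<in> ?A" "e = ?p b" by blast
    show "e \<in> ?A"
    proof (cases b)
      case (Old a)
      then have "a \<in> arcs (graph M)" using b(1) by auto
      then show ?thesis using rot_arcs[of a] unfolding b(2) Old
        by (cases rule: Old_rot_cases[of a]) auto
    qed (use b(2) c_arcs in auto)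
  qed
  have surj: "?A \<subseteq> ?p ` ?A"
  proof
    fix e assume e: "e \<in> ?A"
    show "e \<in> ?p ` ?A"
    proof (cases e)
      case (Old a)
      then have a: "a \<in> arcs (graph M)" using e by auto
      obtain b where b: "a = rot M b" using rot_permutes by (metis permutes_surj surjD)
      show ?thesis
      proof (cases "a \<in> range c")
        case True
        then obtain i where "e = ?p (Spoke i False)" using Old by auto
        then show ?thesis using ext_arc_in_apex_loops(2) by (metis image_eqI plus_map_simps(1))
      next
        case False
        then have "e = ?p (Old b)" using Old b by simp
        moreover have "Old b \<in> ?A" using a b rot_arcs by simp
        ultimately show ?thesis by blast
      qed
    next
      case (Spoke i out)
      obtain b where b: "c i = rot M b" using rot_permutes by (metis permutes_surj surjD)
      have "e = ?p (if out then Loop i False else Old b)"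
        using Spoke rot_corner[OF b[symmetric]] by simp
      moreover have "(if out then Loop i False else Old b) \<in> ?A"
        using b rot_arcs[of b] c_arcs[of i] ext_arc_in_apex_loops
        by (metis plus_map_simps(1))
      ultimately show ?thesis by blast
    next
      case (Loop i d)
      have "e = ?p (if d then Spoke (i + 1) True else Loop (i + 1) True)" using Loop by simp
      moreover have "(if d then Spoke (i + 1) True else Loop (i + 1) True) \<in> ?A"
        using ext_arc_in_apex_loops(2,3) by (metis plus_map_simps(1))
      ultimately show ?thesis by blast
    qed
  qed
  show "bij_betw ?p ?A ?A"
    using maps surj finite_surj_inj[OF fin surj] by (simp add: bij_betw_def subset_antisym)
next
  fix e assume e: "e \<notin> arcs (graph T)"
  show "plus_rot M c e = e"
  proof (cases e)
    case (Old a)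
    then have "a \<notin> arcs (graph M)" using e by auto
    moreover from this have "rot M a = a" using rot_permutes by (simp add: permutes_not_in)
    moreover have "a \<notin> range c" using c_arcs calculation(1) by blast
    ultimately show ?thesis using Old by simp
  qed (use e ext_arc_in_apex_loops in simp_all)
qed

lemma three_sub_cycle: "(j :: 3) = i \<or> j = i + 1 \<or> j = i + 1 + 1"
  using exhaust_three[of i] exhaust_three[of j] by auto

lemma three_minus_two: "(i :: 3) - 1 - 1 = i + 1"
  using exhaust_three[of i] by auto

lemma plus_rot_cyclic_None: "cyclic_on (plus_rot M c) (out_arcs (graph T) None)"
proof -
  have out: "out_arcs (graph T) None = {Spoke i True | i. True} \<union> {Loop i d | i d. True}"
    by (auto simp: out_arcs_def)
  show ?thesis
    unfolding out
  proof (rule cyclic_onI_closed)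
    fix B :: "'b ext_arc set"
    assume B: "B \<subseteq> {Spoke i True | i. True} \<union> {Loop i d | i d. True}" "B \<noteq> {}"
      and closed: "\<And>e. e \<in> B \<Longrightarrow> plus_rot M c e \<in> B"
    have S: "Loop (i - 1) True \<in> B" if "Spoke i True \<in> B" for i using closed[OF that] by simp
    have LT: "Loop (i - 1) False \<in> B" if "Loop i True \<in> B" for i using closed[OF that] by simp
    have LF: "Spoke i True \<in> B" if "Loop i False \<in> B" for i using closed[OF that] by simp
    obtain e where e: "e \<in> B" using B(2) by blast
    have "\<exists>i. Spoke i True \<in> B"
    proof (cases e)
      case (Spoke i out)
      then have "out" using subsetD[OF B(1) e] by simp
      then show ?thesis using e Spoke by auto
    next
      case (Loop i d)
      then show ?thesis using e LF[of i] LF[OF LT[of i]] by (cases d) auto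
    qed (use subsetD[OF B(1) e] in simp)
    then obtain i where i: "Spoke i True \<in> B" ..
    have next_spoke: "Spoke (i + 1) True \<in> B" if "Spoke i True \<in> B" for i
      using LF[OF LT[OF S[OF that]]] by (simp add: three_minus_two)
    have spokes: "Spoke j True \<in> B" for j
      using three_sub_cycle[of j i] i next_spoke[OF i] next_spoke[OF next_spoke[OF i]] by auto
    have loops: "Loop j True \<in> B" for j
      using S[OF spokes[of "j + 1"]] by simp
    have "Loop j d \<in> B" for j d
      using loops[of j] LT[OF loops[of "j + 1"]] by (cases d) simp_all
    then show "{Spoke i True | i. True} \<union> {Loop i d | i d. True} \<subseteq> B"
      using spokes by auto
  next
    have "Spoke 0 True \<in> {Spoke i True :: 'b ext_arc | i. True} \<union> {Loop i d | i d. True}" by blast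
    then show "{Spoke i True :: 'b ext_arc | i. True} \<union> {Loop i d | i d. True} \<noteq> {}" by blast
  qed (auto simp: all_bool_eq ex_bool_eq)
qed

text \<open>The old arcs in a closed set form a set closed under \<open>rot M\<close>, because a
  spoke at a corner is followed by the arc that it was inserted before. They are thus all old arcs
  at \<open>u\<close>, and every spoke at \<open>u\<close> is the successor of one of them.\<close>

lemma plus_rot_cyclic_Some:
  assumes "out_arcs (graph T) (Some u) \<noteq> {}"
  shows "cyclic_on (plus_rot M c) (out_arcs (graph T) (Some u))"
proof (rule cyclic_onI_closed[OF assms])
  have out: "e \<in> out_arcs (graph T) (Some u) \<longleftrightarrow>
      (\<exists>a \<in> out_arcs (graph M) u. e = Old a) \<or> (\<exists>i. e = Spoke i False \<and> x i = u)" for e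
    by (cases e) auto
  have corner: "c i \<in> out_arcs (graph M) u" if "x i = u" for i using that c_arcs tail_c by simp
  fix e assume e: "e \<in> out_arcs (graph T) (Some u)"
  show "plus_rot M c e \<in> out_arcs (graph T) (Some u)"
    using e[unfolded out]
  proof (elim disjE bexE exE conjE)
    fix a assume a: "a \<in> out_arcs (graph M) u" "e = Old a"
    have ra: "rot M a \<in> out_arcs (graph M) u" using a(1) rot_arcs[of a] tail_rot[of a] by simp
    show ?thesis
    proof (cases rule: Old_rot_cases[of a])
      case (1 i)
      then have "x i = u" using ra tail_c[of i] by simp
      then show ?thesis unfolding out a(2) 1(2) by blast
    next
      case 2
      then show ?thesis using ra unfolding out a(2) 2(2) by blast
    qed
  next
    fix i assume "e = Spoke i False" "x i = u"
    then show ?thesis using corner unfolding out by simp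
  qed
next
  have out: "e \<in> out_arcs (graph T) (Some u) \<longleftrightarrow>
      (\<exists>a \<in> out_arcs (graph M) u. e = Old a) \<or> (\<exists>i. e = Spoke i False \<and> x i = u)" for e
    by (cases e) auto
  have corner: "c i \<in> out_arcs (graph M) u" if "x i = u" for i using that c_arcs tail_c by simp
  fix B :: "'b ext_arc set"
  assume B: "B \<subseteq> out_arcs (graph T) (Some u)" "B \<noteq> {}"
    and closed: "\<And>e. e \<in> B \<Longrightarrow> plus_rot M c e \<in> B"
  let ?B = "{a. Old a \<in> B}"
  have step: "Old (rot M a) \<in> B" if "Old a \<in> B" for a
  proof (cases rule: Old_rot_cases[of a])
    case (1 i)
    then have "Spoke i False \<in> B" using closed[OF that] by simp
    then show ?thesis using closed[of "Spoke i False"] 1 by simp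
  next
    case 2
    then show ?thesis using closed[OF that] by simp
  qed
  obtain e where e: "e \<in> B" using B(2) by blast
  have "\<exists>a. Old a \<in> B"
    using subsetD[OF B(1) e, unfolded out]
  proof (elim disjE bexE exE conjE)
    show "\<exists>a. Old a \<in> B" if "e = Spoke i False" for i
      using closed[OF e] that by auto
  qed (use e in auto)
  then obtain a where a: "Old a \<in> B" ..
  then have "a \<in> out_arcs (graph M) u" using subsetD[OF B(1) a, unfolded out] by blast
  then have "a \<in> arcs (graph M)" "tail (graph M) a = u" by simp_all
  then have cyc: "cyclic_on (rot M) (out_arcs (graph M) u)" using cyclic_on_rot[of a] by simp
  have "?B \<subseteq> out_arcs (graph M) u"
  proof
    fix b assume "b \<in> ?B"
    then have "Old b \<in> B" by simp
    from subsetD[OF B(1) this, unfolded out] show "b \<in> out_arcs (graph M) u" by blast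
  qed
  then have full: "?B = out_arcs (graph M) u"
    using a step by (intro cyclic_on_closed_subset[OF cyc]) auto
  show "out_arcs (graph T) (Some u) \<subseteq> B"
  proof
    fix e assume "e \<in> out_arcs (graph T) (Some u)"
    then show "e \<in> B"
      unfolding out
    proof (elim disjE bexE exE conjE)
      fix i assume i: "e = Spoke i False" "x i = u"
      obtain b where b: "rot M b = c i" using rot_permutes by (metis permutes_surj surjD)
      then have "b \<in> out_arcs (graph M) u"
        using corner[OF i(2)] rot_arcs[of b] tail_rot[of b] by simp
      then have "Old b \<in> B" using full by blast
      then show "e \<in> B" using closed[of "Old b"] rot_corner[OF b] i(1) by simp
    qed (use full in blast)
  qed
qed

lemma plus_connected: "connected (graph T)"
  unfolding connected_iff_closed
proof (intro conjI allI impI)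
  let ?V = "verts (graph T)"
  show "?V \<noteq> {}" by simp
  fix C assume "C \<subseteq> ?V" and C: "C \<noteq> {} \<and> closed_within (graph T) ?V C"
  have spoke: "None \<in> C \<longleftrightarrow> Some (x i) \<in> C" for i
    using closed_withinD[OF conjunct2[OF C], of "Spoke i True"] x_verts
    by (simp add: ex_bool_eq)
  let ?C = "{u. Some u \<in> C}"
  have sub: "?C \<subseteq> verts (graph M)" using \<open>C \<subseteq> ?V\<close> by auto
  have "head (graph M) a \<in> ?C" if "a \<in> arcs (graph M)" "tail (graph M) a \<in> ?C" for a
    using closed_withinD[OF conjunct2[OF C], of "Old a"] that by simp
  then have full: "?C = verts (graph M)" if "?C \<noteq> {}" using no_proper_closed[OF sub that] by blast
  obtain w where w: "w \<in> C" using C by blast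
  then have "?C \<noteq> {}" using spoke by (cases w) auto
  then have "?C = verts (graph M)" by (rule full)
  moreover from this have "None \<in> C" using spoke x_verts by blast
  ultimately show "C = ?V" using \<open>C \<subseteq> ?V\<close> by auto
qed

lemma plus_combinatorial_map: "combinatorial_map T"
proof -
  have ends: "tail (graph T) e \<in> verts (graph T) \<and> head (graph T) e \<in> verts (graph T)"
    if "e \<in> arcs (graph T)" for e
    using that x_verts by (cases e) auto
  have opp: "(e \<in> arcs (graph T) \<longleftrightarrow> opp T e \<noteq> e) \<and> opp T (opp T e) = e" for e
    using arev_dom by (cases e) auto
  have tail_opp: "tail (graph T) (opp T e) = head (graph T) e" if "e \<in> arcs (graph T)" for e
    using that by auto
  show ?thesis
  proof
    show "finite (verts (graph T))" "finite (arcs (graph T))" by simp_all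
    show "rot T permutes arcs (graph T)" using plus_rot_permutes by simp
    show "connected (graph T)" by (rule plus_connected)
    fix u assume "out_arcs (graph T) u \<noteq> {}"
    then show "cyclic_on (rot T) (out_arcs (graph T) u)"
      using plus_rot_cyclic_None plus_rot_cyclic_Some by (cases u) auto
  qed (use ends opp tail_opp in metis)+
qed

end

section \<open>Faces and Euler characteristic of the constructed map\<close>

context plus_construction
begin

interpretation T: combinatorial_map T by (rule plus_combinatorial_map)

lemma face_succ_plus:
  "face_succ T (Spoke i True) = Old (c i)"
  "face_succ T (Spoke i False) = Loop (i - 1) True"
  "face_succ T (Loop i True) = Spoke i True"
  "face_succ T (Loop i False) = Loop (i - 1) False"
  by (simp_all add: face_succ_def)

lemma face_succ_Old_corner: "face_succ M a = c i \<Longrightarrow> face_succ T (Old a) = Spoke i False"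
  using rot_corner[of "opp M a"] by (simp add: face_succ_def)

lemma face_succ_Old_other:
  "face_succ M a \<notin> range c \<Longrightarrow> face_succ T (Old a) = Old (face_succ M a)"
  using rot_no_corner[of "opp M a"] by (simp add: face_succ_def)

definition position :: "nat \<Rightarrow> 'b" where "position k = (face_succ M ^^ k) (c 0)"

lemma f_orbit: "orbit (face_succ M) (c 0) = f"
  using f_eq[OF c_in, of 0] by (simp add: face_of_def)

lemma c0_orbit: "c 0 \<in> orbit (face_succ M) (c 0)"
  using c_in f_orbit by simp

lemma position_bij: "bij_betw position {0..<card f} f"
  using bij_betw_funpow_orbit(1)[OF c0_orbit] unfolding f_orbit position_def .

lemma position_Suc: "face_succ M (position k) = position (Suc k)"
  by (simp add: position_def)

lemma position_start: "position (start i) = c i"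
  unfolding position_def by (rule c_start[symmetric])

text \<open>For \<open>i = 2\<close> the segment ends at \<open>card f\<close>, one full turn around
  the face. The walk is then back at \<open>c 0\<close>, and \<open>2 + 1 = 0\<close> in the index
  type.\<close>

lemma position_stop: "position (stop i) = c (i + 1)"
proof -
  have "position (card f) = c 0"
    using bij_betw_funpow_orbit(2)[OF c0_orbit] unfolding f_orbit position_def .
  then show ?thesis
    using exhaust_three[of i] position_start[of 1] position_start[of 2]
    by (auto simp: stop_0 stop_1 stop_2)
qed

lemma stop_le: "stop i \<le> card f"
  using exhaust_three[of i] start_stop[of 0] start_stop[of 1] start_stop[of 2]
  by (auto simp: stop_0 stop_1 stop_2)

lemma start_not_between: "start i < k \<Longrightarrow> k < stop i \<Longrightarrow> k \<noteq> start j"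
  using exhaust_three[of i] exhaust_three[of j] start_stop[of 0] start_stop[of 1] start_stop[of 2]
  by (auto simp: stop_0 stop_1 stop_2 start_0)

definition segment_face :: "3 \<Rightarrow> 'b ext_arc set" where
  "segment_face i = {Spoke i True, Loop i True, Spoke (i + 1) False} \<union>
     Old ` position ` {start i..<stop i}"

lemma segment_face_closed:
  assumes "e \<in> segment_face i"
  shows "face_succ T e \<in> segment_face i"
proof -
  \<comment> \<open>The last arc of the segment is followed by the spoke at corner
    \<open>i + 1\<close>. No earlier arc is followed by a corner, because positions below
    \<open>card f\<close> are distinct and no start lies strictly inside a segment.\<close>
  have old: "face_succ T (Old (position k)) \<in> segment_face i" if k: "start i \<le> k" "k < stop i" for k
  proof (cases "Suc k = stop i")
    case True
    then have "face_succ M (position k) = c (i + 1)"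
      using position_stop[of i] position_Suc[of k] by simp
    then show ?thesis using face_succ_Old_corner by (simp add: segment_face_def)
  next
    case False
    then have less: "start i < Suc k" "Suc k < stop i" using k by simp_all
    have "position (Suc k) \<noteq> c j" for j
    proof
      assume "position (Suc k) = c j"
      then have "position (Suc k) = position (start j)" by (simp add: position_start)
      moreover have "Suc k < card f" "start j < card f"
        using less(2) stop_le[of i] stop_le[of j] start_stop[of j] by simp_all
      ultimately have "Suc k = start j"
        using position_bij unfolding bij_betw_def by (auto dest: inj_onD)
      then show False using start_not_between[OF less] by blast
    qed
    then have "face_succ M (position k) \<notin> range c" by (auto simp: position_Suc)
    then have "face_succ T (Old (position k)) = Old (position (Suc k))"
      by (simp add: face_succ_Old_other position_Suc)
    then show ?thesis using less by (auto simp: segment_face_def)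
  qed
  have "Old (c i) \<in> segment_face i"
    using start_stop[of i] position_start[of i] unfolding segment_face_def by force
  moreover have "Spoke i True \<in> segment_face i" "Loop i True \<in> segment_face i"
    by (simp_all add: segment_face_def)
  moreover from assms have "e = Spoke i True \<or> e = Loop i True \<or> e = Spoke (i + 1) False \<or>
      (\<exists>k. start i \<le> k \<and> k < stop i \<and> e = Old (position k))"
    unfolding segment_face_def by auto
  ultimately show ?thesis by (elim disjE exE conjE) (simp_all add: face_succ_plus old)
qed

definition plus_face :: "3 \<Rightarrow> 'b ext_arc set" where
  "plus_face i = face_of T (Spoke i True)"

text \<open>This inclusion is the upper bound used below: it shows that each of these faces contains
  just one outgoing spoke, and that a single loop and two spokes are the only arcs in it that can
  have nonzero displacement.\<close>

lemma plus_face_subset: "plus_face i \<subseteq> segment_face i"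
proof
  fix e assume "e \<in> plus_face i"
  then have "e \<in> orbit (face_succ T) (Spoke i True)" by (simp add: plus_face_def face_of_def)
  moreover have "Spoke i True \<in> segment_face i" by (simp add: segment_face_def)
  ultimately show "e \<in> segment_face i" by induction (simp_all add: segment_face_closed)
qed

lemma face_of_plus_simps:
  "face_of T (Spoke i True) = plus_face i"
  "face_of T (Loop i True) = plus_face i"
  "face_of T (Spoke i False) = plus_face (i - 1)"
  "face_of T (Old (c i)) = plus_face i"
proof -
  show spoke: "face_of T (Spoke i True) = plus_face i" for i by (simp add: plus_face_def)
  show loop: "face_of T (Loop i True) = plus_face i" for i
    using T.face_of_face_succ[of "Loop i True"] by (simp only: face_succ_plus spoke)
  show "face_of T (Spoke i False) = plus_face (i - 1)"
    using T.face_of_face_succ[of "Spoke i False"] by (simp only: face_succ_plus loop)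
  show "face_of T (Old (c i)) = plus_face i"
    using T.face_of_face_succ[of "Spoke i True"] by (simp only: face_succ_plus spoke)
qed

text \<open>Follow the old outer boundary from \<open>c 0\<close>: at a corner the face is known,
  and elsewhere the successor of an arc is unchanged, so its face is too.\<close>

lemma face_of_outer:
  assumes "a \<in> f"
  shows "face_of T (Old a) \<in> range plus_face"
proof -
  have "a \<in> orbit (face_succ M) (c 0)" using assms f_orbit by simp
  moreover have step: "face_of T (Old (face_succ M b)) \<in> range plus_face"
    if "face_of T (Old b) \<in> range plus_face" for b
  proof (cases "face_succ M b \<in> range c")
    case True
    then show ?thesis by (auto simp: face_of_plus_simps)
  next
    case False
    then show ?thesis using T.face_of_face_succ[of "Old b"] that
      by (simp add: face_succ_Old_other)
  qed
  ultimately show ?thesis by induction (simp_all add: step face_of_plus_simps)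
qed

lemma face_of_inner:
  assumes "a \<in> arcs (graph M)" "a \<notin> f"
  shows "face_of T (Old a) = Old ` face_of M a"
proof (rule face_of_Old[where K = "range c"])
  have "face_of M a \<noteq> f" using assms(2) face_of_self[of a] by blast
  moreover have "face_of M a \<in> faces M" using assms(1) by (simp add: faces_eq[OF arcs_ne])
  ultimately have "face_of M a \<inter> f = {}" using faces_disjoint[OF arcs_ne _ f_face] by blast
  then show "face_of M a \<inter> range c = {}" using c_in by blast
qed (use assms in simp_all)

text \<open>The three loops triangulate the torus with two triangles. One of them contains the
  planar map and is subdivided by the spokes; this is the other one.\<close>

definition loop_face :: "'b ext_arc set" where
  "loop_face = {Loop 0 False, Loop 1 False, Loop 2 False}"

lemma loop_face_Loop: "Loop i False \<in> loop_face"
  using exhaust_three[of i] by (auto simp: loop_face_def)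

lemma face_of_Loop_False: "face_of T (Loop i False) = loop_face"
proof -
  have step: "face_of T (Loop (j - 1) False) = face_of T (Loop j False)" for j
    using T.face_of_face_succ[of "Loop j False"] by (simp only: face_succ_plus)
  have same: "face_of T (Loop j False) = face_of T (Loop 0 False)" for j
    using exhaust_three[of j] step[of 1] step[of 2] by auto
  have "face_of T (Loop 0 False) \<subseteq> loop_face"
  proof
    fix e assume "e \<in> face_of T (Loop 0 False)"
    then have "e \<in> orbit (face_succ T) (Loop 0 False)" by (simp add: face_of_def)
    then show "e \<in> loop_face"
    proof induction
      case (step e)
      then show ?case by (auto simp: loop_face_def face_succ_plus)
    qed (simp add: face_succ_plus loop_face_Loop)
  qed
  moreover have "Loop j False \<in> face_of T (Loop 0 False)" for j
    using T.face_of_self[of "Loop j False"] same[of j] by simp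
  then have "loop_face \<subseteq> face_of T (Loop 0 False)" by (simp add: loop_face_def)
  ultimately show ?thesis using same by blast
qed

lemma faces_plus:
  "faces T = insert loop_face (range plus_face) \<union> (`) Old ` (faces M - {f})" (is "_ = ?R")
proof -
  have ne: "arcs (graph T) \<noteq> {}" using ext_arc_in_apex_loops(2)[of 0 True "graph M" x] by auto
  have sub: "face_of T e \<in> ?R" if e: "e \<in> arcs (graph T)" for e
  proof (cases e)
    case (Old a)
    then have a: "a \<in> arcs (graph M)" using e by auto
    show ?thesis
    proof (cases "a \<in> f")
      case True
      then show ?thesis using face_of_outer Old by auto
    next
      case False
      then have "face_of M a \<in> faces M - {f}"
        using a face_of_self[of a] by (auto simp: faces_eq[OF arcs_ne])
      then show ?thesis using face_of_inner[OF a False] Old by blast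
    qed
  next
    case (Spoke i out)
    then show ?thesis by (cases out) (simp_all add: face_of_plus_simps)
  next
    case (Loop i d)
    then show ?thesis by (cases d) (simp_all add: face_of_plus_simps face_of_Loop_False)
  qed
  have sup: "g \<in> face_of T ` arcs (graph T)" if "g \<in> ?R" for g
    using that
  proof (elim UnE insertE)
    assume "g = loop_face"
    then show ?thesis using face_of_Loop_False[of 0] ext_arc_in_apex_loops(3)
      by (metis image_eqI plus_map_simps(1))
  next
    assume "g \<in> range plus_face"
    then obtain i where "g = face_of T (Spoke i True)" by (auto simp: plus_face_def)
    then show ?thesis using ext_arc_in_apex_loops(2) by (metis image_eqI plus_map_simps(1))
  next
    assume "g \<in> (`) Old ` (faces M - {f})"
    then obtain h where h: "h \<in> faces M" "h \<noteq> f" "g = Old ` h" by blast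
    then obtain a where a: "a \<in> arcs (graph M)" "h = face_of M a"
      by (auto simp: faces_eq[OF arcs_ne])
    then have "a \<notin> f" using h(2) f_eq by blast
    then have "g = face_of T (Old a)" using face_of_inner a h(3) by simp
    moreover have "Old a \<in> arcs (graph T)" using a(1) by simp
    ultimately show ?thesis by blast
  qed
  show ?thesis
    unfolding T.faces_eq[OF ne]
  proof (rule subset_antisym)
    show "face_of T ` arcs (graph T) \<subseteq> ?R" by (rule image_subsetI) (rule sub)
    show "?R \<subseteq> face_of T ` arcs (graph T)" by (rule subsetI) (rule sup)
  qed
qed

lemma Spoke_True_in_plus_face: "Spoke i True \<in> plus_face j \<longleftrightarrow> i = j"
proof
  assume "Spoke i True \<in> plus_face j"
  then have "Spoke i True \<in> segment_face j" using plus_face_subset by blast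
  then show "i = j" by (auto simp: segment_face_def)
next
  show "i = j \<Longrightarrow> Spoke i True \<in> plus_face j"
    using T.face_of_self[of "Spoke i True"] by (simp add: plus_face_def)
qed

text \<open>The outer face gives way to three segment faces and the empty triangle of loops, a net
  gain of three.\<close>

lemma card_faces_plus: "card (faces T) = card (faces M) + 3"
proof -
  have finF: "finite (faces M)" by (simp add: faces_eq[OF arcs_ne])
  have "inj plus_face" using Spoke_True_in_plus_face by (intro injI) metis
  then have "card (range plus_face) = 3" by (rule card_range_three)
  moreover have "loop_face \<notin> range plus_face"
    using Spoke_True_in_plus_face by (auto simp: loop_face_def)
  ultimately have "card (insert loop_face (range plus_face)) = 4" by simp
  moreover have "card ((`) Old ` (faces M - {f})) = card (faces M) - 1"
    using f_face finF
    by (subst card_image) (auto intro!: inj_onI simp: inj_image_eq_iff inj_def)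
  moreover have "insert loop_face (range plus_face) \<inter> (`) Old ` (faces M - {f}) = {}"
  proof -
    have "Loop 0 False \<in> loop_face" "Loop 0 False \<notin> Old ` g" for g :: "'b set"
      by (auto simp: loop_face_def)
    moreover have "Spoke i True \<in> plus_face i" "Spoke i True \<notin> Old ` g" for i and g :: "'b set"
      by (auto simp: Spoke_True_in_plus_face)
    ultimately show ?thesis by blast
  qed
  then have "card (faces T) =
      card (insert loop_face (range plus_face)) + card ((`) (Old :: 'b \<Rightarrow> 'b ext_arc) ` (faces M - {f}))"
    unfolding faces_plus using finF by (intro card_Un_disjoint) simp_all
  moreover have "card (faces M) \<noteq> 0" using f_face finF by auto
  ultimately show ?thesis by linarith
qed

text \<open>One new vertex, six new edges and three additional faces: 1 - 6 + 3 = -2.\<close>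

lemma euler_char_plus: "euler_char T = euler_char M - 2"
proof -
  let ?S = "{Spoke i out :: 'b ext_arc | i out. True}" and ?L = "{Loop i d :: 'b ext_arc | i d. True}"
  have "card (verts (graph T)) = card (verts (graph M)) + 1" by (simp add: card_image)
  moreover have "card (arcs (graph T)) = card (arcs (graph M)) + 12"
  proof -
    have "card (arcs (graph T)) = card (Old ` arcs (graph M) \<union> ?S \<union> ?L)" by simp
    also have "\<dots> = card (Old ` arcs (graph M) \<union> ?S) + card ?L"
      by (intro card_Un_disjoint) auto
    also have "card (Old ` arcs (graph M) \<union> ?S) = card (Old ` arcs (graph M)) + card ?S"
      by (intro card_Un_disjoint) auto
    also have "card (Old ` arcs (graph M)) = card (arcs (graph M))"
      by (intro card_image inj_onI) simp
    finally show ?thesis unfolding card_ext_arcs by simp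
  qed
  ultimately show ?thesis unfolding euler_char_def card_faces_plus by simp
qed

section \<open>Displacements, loops and connectivity of the constructed map\<close>

lemma plus_shift_opp: "plus_shift (opp T e) = - plus_shift e"
  by (cases e) simp_all

text \<open>On the triangle of loops the corner shifts telescope. On a segment face the two spokes
  contribute the difference of two corner shifts, which the loop between these corners
  cancels.\<close>

lemma plus_shift_faces:
  assumes "g \<in> faces T"
  shows "sum plus_shift g = 0"
  using assms unfolding faces_plus
proof (elim UnE insertE)
  assume "g = loop_face"
  then show ?thesis by (simp add: loop_face_def zero_prod_def)
next
  assume "g \<in> range plus_face"
  then obtain i where g: "g = plus_face i" by blast
  let ?B = "{Spoke i True, Loop i True, Spoke (i + 1) False} :: 'b ext_arc set"
  have "Spoke (i + 1) False \<in> plus_face i"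
    using T.face_of_self[of "Spoke (i + 1) False"] by (simp add: face_of_plus_simps)
  moreover have "Spoke i True \<in> plus_face i" "Loop i True \<in> plus_face i"
    using T.face_of_self[of "Spoke i True"] T.face_of_self[of "Loop i True"]
    by (simp_all add: face_of_plus_simps)
  ultimately have "?B \<subseteq> plus_face i" by simp
  moreover have "plus_shift e = 0" if "e \<in> plus_face i - ?B" for e
    using that plus_face_subset[of i] by (auto simp: segment_face_def)
  moreover have "finite (plus_face i)"
  proof (rule finite_subset[OF _ T.finite_arcs])
    show "plus_face i \<subseteq> arcs (graph T)"
      unfolding plus_face_def using ext_arc_in_apex_loops(2)[of i True "graph M" x]
      by (intro T.face_of_subset) simp
  qed
  ultimately have "sum plus_shift (plus_face i) = sum plus_shift ?B"
    by (intro sum.mono_neutral_right) auto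
  then show ?thesis unfolding g by simp
next
  assume "g \<in> (`) Old ` (faces M - {f})"
  then show ?thesis by (auto intro!: sum.neutral)
qed

lemma plus_toroidal: "euler_char M = 2 \<Longrightarrow> toroidal_map T"
  using plus_combinatorial_map euler_char_plus by (simp add: toroidal_map_def)

lemma plus_shift_homotopic:
  "homotopic_walks T p q \<Longrightarrow> sum_list (map plus_shift p) = sum_list (map plus_shift q)"
  using T.homotopic_walks_sum_eq[OF plus_shift_opp plus_shift_faces] by blast

lemma plus_shift_Loop_neq:
  "plus_shift (Loop i True :: 'b ext_arc) \<noteq> 0"
  "i \<noteq> j \<Longrightarrow> plus_shift (Loop i True :: 'b ext_arc) \<noteq> plus_shift (Loop j d :: 'b ext_arc)"
  using exhaust_three[of i] exhaust_three[of j] by (cases d; auto simp: zero_prod_def)+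

lemma plus_is_plus_map:
  assumes "euler_char M = 2"
  shows "is_plus_map M f x T"
proof -
  have "ccw_corners M f x c"
    unfolding ccw_corners_def
  proof (intro conjI)
    show "\<exists>m n. 0 < m \<and> m < n \<and> n < card f \<and>
        c 1 = (face_succ M ^^ m) (c 0) \<and> c 2 = (face_succ M ^^ n) (c 0)"
      using start_stop[of 0] start_stop[of 1] start_stop[of 2]
      by (intro exI[of _ "start 1"] exI[of _ "start 2"] conjI c_start)
        (simp_all add: stop_0 stop_1 stop_2 start_0)
  qed (use c_in tail_c in auto)
  then have "\<exists>c'. ccw_corners M f x c' \<and>
      (\<forall>a \<in> arcs (graph M). rot M a \<notin> range c' \<longrightarrow> rot T (Old a) = Old (rot M a)) \<and>
      (\<forall>a \<in> arcs (graph M). \<forall>i. rot M a = c' i \<longrightarrow> rot T (Old a) = Spoke i False) \<and>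
      (\<forall>i. rot T (Spoke i False) = Old (c' i))"
    using rot_corner rot_no_corner by (intro exI[of _ c]) simp
  moreover have "\<not> contractible_loop T (Loop i True)" for i
    using plus_shift_homotopic[of "[Loop i True]" "[]"] plus_shift_Loop_neq(1)[of i]
    by (auto simp: contractible_loop_def)
  moreover have "\<not> homotopic_loops T (Loop i True) (Loop j True)" if "i \<noteq> j" for i j
    using plus_shift_homotopic[of "[Loop i True]" "[Loop j True]"]
      plus_shift_homotopic[of "[Loop i True]" "[Loop j False]"]
      plus_shift_Loop_neq(2)[OF that, of True] plus_shift_Loop_neq(2)[OF that, of False]
    by (auto simp: homotopic_loops_def simp del: plus_shift.simps)
  ultimately show ?thesis
    using plus_toroidal[OF assms] unfolding is_plus_map_def by simp
qed

text \<open>Connectivity of the cover is established before \<open>flat_representation\<close>,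
  since it supplies the closed walks that realize every translation.\<close>

lemma plus_essentially_3_connected:
  assumes "euler_char M = 2" and conn: "apex_3_connected (graph M) (range x)"
  shows "essentially_3_connected T"
proof -
  let ?U = "universal_cover (graph T) plus_shift"
  have k: "k_connected 3 ?U"
    using k_connected_universal_cover[OF finite_verts _ inj_x conn] x_verts by auto
  then have "connected (?U \<restriction> (verts ?U - {}))"
    unfolding k_connected_def by (metis card.empty empty_subsetI finite.emptyI zero_less_numeral)
  from this[unfolded connected_induce_iff_closed Diff_empty] have U: "connected ?U"
    unfolding connected_iff_closed .
  have "flat_representation T plus_shift"
    unfolding flat_representation_def
  proof (intro conjI ballI allI)
    show "plus_shift (opp T a) = - plus_shift a" for a by (rule plus_shift_opp)
    show "sum plus_shift g = 0" if "g \<in> faces T" for g using that by (rule plus_shift_faces)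
    show "\<exists>p. T.awalk u p u \<and> sum_list (map plus_shift p) = z" if "u \<in> verts (graph T)" for u z
      by (rule T.closed_walk_of_shift[of plus_shift, OF _ U that]) (rule plus_shift_opp)
  qed
  with k show ?thesis
    unfolding essentially_3_connected_def using plus_toroidal[OF assms(1)] by blast
qed

end

section \<open>The characterization\<close>

text \<open>Any corner of \<open>f\<close> at each chosen vertex will do. Their positions along the
  boundary walk from the first corner decide the order, so the vertices may have to be renumbered,
  but their set stays the same.\<close>

lemma plus_construction_exists:
  assumes "combinatorial_map M" "f \<in> faces M" "arcs (graph M) \<noteq> {}"
    and x: "inj x" "range x \<subseteq> face_verts M f"
  obtains y c start stop where "plus_construction M f y c start stop" "range y = range (x :: 3 \<Rightarrow> 'a)"
proof -
  interpret combinatorial_map M by fact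
  have "\<exists>b. b \<in> f \<and> tail (graph M) b = x i" for i
    using subsetD[OF x(2) rangeI, of i] assms(3) unfolding face_verts_def by auto
  then obtain b where b: "\<And>i. b i \<in> f" "\<And>i. tail (graph M) (b i) = x i" by metis
  obtain a where a: "f = face_of M a" using assms(2,3) by (auto simp: faces_eq)
  have f: "f = orbit (face_succ M) (b 0)"
    using face_of_eq[of "b 0" a] b(1)[of 0] a by (simp add: face_of_def)
  have self: "b 0 \<in> orbit (face_succ M) (b 0)" using b(1)[of 0] f by simp
  have img: "(\<lambda>k. (face_succ M ^^ k) (b 0)) ` {0..<card f} = f"
    using bij_betw_funpow_orbit(1)[OF self] unfolding f[symmetric] bij_betw_def by blast
  have pos: "\<exists>k < card f. b i = (face_succ M ^^ k) (b 0)" for i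
  proof -
    have "b i \<in> (\<lambda>k. (face_succ M ^^ k) (b 0)) ` {0..<card f}" unfolding img by (rule b(1))
    then show ?thesis by auto
  qed
  obtain k1 where k1: "k1 < card f" "b 1 = (face_succ M ^^ k1) (b 0)" using pos by blast
  obtain k2 where k2: "k2 < card f" "b 2 = (face_succ M ^^ k2) (b 0)" using pos by blast
  have neq: "b i \<noteq> b j" if "i \<noteq> j" for i j using that b(2) x(1) by (metis injD)
  have k: "0 < k1" "0 < k2" "k1 \<noteq> k2"
    using k1(2) k2(2) neq[of 0 1] neq[of 0 2] neq[of 1 2] by (auto intro: Nat.gr0I)
  \<comment> \<open>Exchanges the indices 1 and 2 when the third corner precedes the second on the
    boundary walk.\<close>
  define s :: "3 \<Rightarrow> 3" where "s i = (if i = 0 \<or> k1 < k2 then i else if i = 1 then 2 else 1)" for i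
  define start where "start i = (if i = 0 then 0 else if i = 1 then min k1 k2 else max k1 k2)" for i :: 3
  define stop where "stop i = (if i = 0 then min k1 k2 else if i = 1 then max k1 k2 else card f)" for i :: 3
  have "s (s i) = i" for i using exhaust_three[of i] by (auto simp: s_def)
  then have s: "bij s" by (intro o_bij[of s s]) auto
  have "plus_construction M f (x \<circ> s) (b \<circ> s) start stop"
  proof
    show "f \<in> faces M" by fact
    show "(b \<circ> s) i \<in> f" "tail (graph M) ((b \<circ> s) i) = (x \<circ> s) i" for i using b by simp_all
    show "inj (x \<circ> s)" using x(1) bij_is_inj[OF s] by (rule inj_compose)
    show "start 0 = 0" "stop 0 = start 1" "stop 1 = start 2" "stop 2 = card f"
      by (simp_all add: start_def stop_def)
    show "start i < stop i" for i
      using exhaust_three[of i] k k1(1) k2(1) by (auto simp: start_def stop_def)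
    show "(b \<circ> s) i = (face_succ M ^^ start i) ((b \<circ> s) 0)" for i
      using exhaust_three[of i] k(3) k1(2)[symmetric] k2(2)[symmetric]
      by (auto simp: start_def s_def min_def max_def)
  qed
  moreover have "range (x \<circ> s) = range x" using bij_is_surj[OF s] by (metis image_comp)
  ultimately show ?thesis by (rule that)
qed

theorem theorem5:
  fixes G :: "('a, 'b) cmap" and f :: "'b set"
  assumes "planar_map G f"
  shows "internally_3_connected G f \<longleftrightarrow>
    (\<exists>x :: 3 \<Rightarrow> 'a. inj x \<and> range x \<subseteq> face_verts G f \<and>
       (\<exists>T. is_plus_map G f x T \<and> essentially_3_connected T))"
proof -
  have map: "combinatorial_map G" and euler: "euler_char G = 2" and f: "f \<in> faces G"
    using assms by (simp_all add: planar_map_def)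
  interpret combinatorial_map G by (rule map)
  have face_verts: "face_verts G f \<subseteq> verts (graph G)"
  proof (cases "arcs (graph G) = {}")
    case False
    then have "f \<subseteq> arcs (graph G)" using f face_of_subset by (auto simp: faces_eq)
    then show ?thesis using False by (auto simp: face_verts_def)
  qed (simp add: face_verts_def)
  have apex: "k_connected 3 (apex_graph (graph G) x) \<longleftrightarrow> apex_3_connected (graph G) (range x)"
    if "inj x" "range x \<subseteq> face_verts G f" for x
    using that face_verts by (intro k_connected_apex_iff) auto
  show ?thesis
  proof
    assume "internally_3_connected G f"
    then obtain x :: "3 \<Rightarrow> 'a" where x: "inj x" "range x \<subseteq> face_verts G f"
      and "k_connected 3 (apex_graph (graph G) x)"
      unfolding internally_3_connected_def by (elim exE conjE)
    then have conn: "apex_3_connected (graph G) (range x)" using apex by simp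
    have x_verts: "x i \<in> verts (graph G)" for i
      using subsetD[OF x(2) rangeI, of i] face_verts by blast
    \<comment> \<open>A connected map without arcs has a single vertex, which leaves no room for
      three distinct ones.\<close>
    have "arcs (graph G) \<noteq> {}"
    proof
      assume empty: "arcs (graph G) = {}"
      have "verts (graph G) = {x 0}"
        using no_proper_closed[of "{x 0}"] empty x_verts[of 0] by auto
      then have "x 0 = x 1" using x_verts[of 1] by simp
      then show False using x(1) by (auto dest: injD)
    qed
    \<comment> \<open>The criterion sees only the set of the three vertices, so it carries over from
      \<open>x\<close> to the reordered \<open>y\<close>.\<close>
    then obtain y c start stop where "plus_construction G f y c start stop"
      and y: "range y = range x"
      using plus_construction_exists[OF map f _ x] by metis
    then interpret plus_construction G f y c start stop by simp
    have "is_plus_map G f y (plus_map G y c)" by (rule plus_is_plus_map[OF euler])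
    moreover have "essentially_3_connected (plus_map G y c)"
      using plus_essentially_3_connected[OF euler] conn y by simp
    ultimately show "\<exists>x :: 3 \<Rightarrow> 'a. inj x \<and> range x \<subseteq> face_verts G f \<and>
        (\<exists>T. is_plus_map G f x T \<and> essentially_3_connected T)"
      using inj_x x(2) y by (intro exI[of _ y] exI[of _ "plus_map G y c"] conjI) simp_all
  next
    assume "\<exists>x :: 3 \<Rightarrow> 'a. inj x \<and> range x \<subseteq> face_verts G f \<and>
        (\<exists>T. is_plus_map G f x T \<and> essentially_3_connected T)"
    then obtain x :: "3 \<Rightarrow> 'a" and T where x: "inj x" "range x \<subseteq> face_verts G f"
      and T: "is_plus_map G f x T" "essentially_3_connected T"
      by (elim exE conjE)
    obtain \<delta> where flat: "flat_representation T \<delta>"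
      and conn: "k_connected 3 (universal_cover (graph T) \<delta>)"
      using T(2) unfolding essentially_3_connected_def by (elim exE conjE)
    have graph: "graph T = apex_loops_graph (graph G) x" "opp T = ext_opp (opp G)"
      using T(1) by (simp_all add: is_plus_map_def)
    obtain \<phi> where \<phi>: "\<forall>a \<in> arcs (graph G).
        \<delta> (Old a) = \<phi> (head (graph G) a) - \<phi> (tail (graph G) a)"
      using planar_potential_of_plus_map[OF assms T(1) flat] ..
    have "\<delta> (Spoke i False) = - \<delta> (Spoke i True)" for i
      using flat_representationD(1)[OF flat, of "Spoke i True"] ext_arc_in_apex_loops(2)
      by (simp add: graph ex_bool_eq)
    then have "apex_3_connected (graph G) (range x)"
      using \<phi> by (intro apex_3_connected_of_cover[OF finite_verts x(1) conn[unfolded graph(1)]]) auto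
    then show "internally_3_connected G f"
      unfolding internally_3_connected_def using x apex[OF x] by blast
  qed
qed

end
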